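(* Fix an integer $d \ge 1$ and real constants $\alpha, \beta \ge 0$, $\lambda > 0$ with $\alpha + \beta + \lambda < d$. Put $$p_- = \frac{d}{d-\alpha}, \qquad p_+ = \frac{d}{d-\alpha-\lambda}, \qquad \kappa = \frac{\alpha+\beta+\lambda}{d}.$$ For $p \in (p_-, p_+)$ let $q = q(p)$ be defined by $$1 + \frac{1}{q} = \frac{1}{p} + \frac{\alpha+\beta+\lambda}{d},$$ and let $$V_{\alpha,\beta,\lambda}(p) = \sup_{f \in L(p_-,p_+),\ f \ne 0} \frac{|I_{\alpha,\beta,\lambda} f|_q}{|f|_p}.$$ Then there exist constants $C_1 = C_1(\alpha,\beta,\lambda) > 0$ and $C_2 = C_2(\alpha,\beta,\lambda) \in (0,\infty)$, independent of $p$ (the dimension $d$ being fixed), such that for every $p \in (p_-,p_+)$ $$\frac{C_1}{\left[(p-p_-)(p_+-p)\right]^{\kappa}} \le V_{\alpha,\beta,\lambda}(p) \le \frac{C_2}{\left[(p-p_-)(p_+-p)\right]^{\kappa}}.$$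
   Context: For $m \in [1,\infty)$, $L_m = L_m(\mathbb{R}^d)$ is the Lebesgue space of measurable functions $f : \mathbb{R}^d \to \mathbb{R}$ with finite norm $|f|_m = \left(\int_{\mathbb{R}^d} |f(x)|^m\, dx\right)^{1/m}$, and $L(a,b) = \bigcap_{p \in (a,b)} L_p$. For $x \in \mathbb{R}^d$, $|x|$ denotes the Euclidean norm. The weight Riesz integral operator (weight Riesz potential) is $$I_{\alpha,\beta,\lambda} f(x) = |x|^{-\beta} \int_{\mathbb{R}^d} \frac{f(y)\, |y|^{-\alpha}}{|x-y|^{\lambda}}\, dy .$$ As $p$ ranges over $(p_-,p_+)$, the exponent $q(p)$ ranges over $(q_-,q_+)$ with $q_- = d/(\beta+\lambda)$ and $q_+ = d/\beta$ (where $q_+ = +\infty$ if $\beta = 0$). *)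

theory Defs
  imports "HOL-Analysis.Analysis"
begin

text \<open>
  The space \<open>\<real>\<^sup>d\<close> is a type \<open>'a::euclidean_space\<close> with \<open>d = DIM('a) \<ge> 1\<close>; \<open>norm\<close> is its
  Euclidean norm. The third parameter of the operator is written \<open>l\<close>, since lambda is a
  keyword.
\<close>

text \<open>The \<open>L\<^sub>m\<close> norm, with the value \<open>\<infinity>\<close> when the integral diverges.\<close>

definition Lnorm :: "real \<Rightarrow> ('a::euclidean_space \<Rightarrow> real) \<Rightarrow> ennreal" where
  "Lnorm m f =
    (let J = \<integral>\<^sup>+ x. ennreal (\<bar>f x\<bar> powr m) \<partial>lebesgue
     in if J = \<infinity> then \<infinity> else ennreal (enn2real J powr (1 / m)))"

definition Lspace :: "real \<Rightarrow> ('a::euclidean_space \<Rightarrow> real) set" where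
  "Lspace m = {f. f \<in> borel_measurable lebesgue \<and> Lnorm m f < \<infinity>}"

definition Linter :: "real \<Rightarrow> real \<Rightarrow> ('a::euclidean_space \<Rightarrow> real) set" where
  "Linter a b = (\<Inter>p\<in>{a<..<b}. Lspace p)"

text \<open>
  Since \<open>0 powr a = 0\<close> for every \<open>a\<close>, the kernel vanishes at \<open>y = 0\<close> and \<open>y = x\<close>, and the
  operator vanishes at \<open>x = 0\<close>, also when the exponent is \<open>0\<close>. These are null sets, so neither
  the integrals nor the norms are affected.
\<close>

definition riesz_integrand ::
  "real \<Rightarrow> real \<Rightarrow> ('a::euclidean_space \<Rightarrow> real) \<Rightarrow> 'a \<Rightarrow> 'a \<Rightarrow> real" where
  "riesz_integrand \<alpha> l f x y = f y * norm y powr (- \<alpha>) / norm (x - y) powr l"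

definition weight_riesz ::
  "real \<Rightarrow> real \<Rightarrow> real \<Rightarrow> ('a::euclidean_space \<Rightarrow> real) \<Rightarrow> 'a \<Rightarrow> real" where
  "weight_riesz \<alpha> \<beta> l f x =
    norm x powr (- \<beta>) * (\<integral>y. riesz_integrand \<alpha> l f x y \<partial>lebesgue)"

text \<open>
  The Bochner integral is \<open>0\<close> for a nonintegrable function. So that this convention
  cannot make the norm of the image of \<open>f\<close> too small, the norm is \<open>\<infinity>\<close> unless the integral
  converges absolutely for almost every \<open>x\<close>.
\<close>

definition weight_riesz_norm ::
  "real \<Rightarrow> real \<Rightarrow> real \<Rightarrow> real \<Rightarrow> ('a::euclidean_space \<Rightarrow> real) \<Rightarrow> ennreal" where
  "weight_riesz_norm \<alpha> \<beta> l q f =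
    (if AE x in lebesgue. integrable lebesgue (riesz_integrand \<alpha> l f x)
     then Lnorm q (weight_riesz \<alpha> \<beta> l f) else \<infinity>)"

definition p_minus :: "nat \<Rightarrow> real \<Rightarrow> real" where
  "p_minus d \<alpha> = real d / (real d - \<alpha>)"

definition p_plus :: "nat \<Rightarrow> real \<Rightarrow> real \<Rightarrow> real" where
  "p_plus d \<alpha> l = real d / (real d - \<alpha> - l)"

definition riesz_kappa :: "nat \<Rightarrow> real \<Rightarrow> real \<Rightarrow> real \<Rightarrow> real" where
  "riesz_kappa d \<alpha> \<beta> l = (\<alpha> + \<beta> + l) / real d"

definition riesz_q :: "nat \<Rightarrow> real \<Rightarrow> real \<Rightarrow> real \<Rightarrow> real \<Rightarrow> real" where
  "riesz_q d \<alpha> \<beta> l p = (THE q. 1 + 1 / q = 1 / p + (\<alpha> + \<beta> + l) / real d)"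

text \<open>
  The condition \<open>f \<noteq> 0\<close> is meant in \<open>L\<^sub>p\<close>: \<open>f\<close> does not vanish almost everywhere. Hence
  the denominators in the supremum are positive and finite for \<open>p\<close> between \<open>p_minus\<close> and
  \<open>p_plus\<close>.
\<close>

definition riesz_V ::
  "'a::euclidean_space itself \<Rightarrow> real \<Rightarrow> real \<Rightarrow> real \<Rightarrow> real \<Rightarrow> ennreal" where
  "riesz_V _ \<alpha> \<beta> l p =
    (SUP f \<in> {f :: 'a \<Rightarrow> real. f \<in> Linter (p_minus DIM('a) \<alpha>) (p_plus DIM('a) \<alpha> l) \<and>
                \<not> (AE x in lebesgue. f x = 0)}.
       weight_riesz_norm \<alpha> \<beta> l (riesz_q DIM('a) \<alpha> \<beta> l p) f / Lnorm p f)"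

lemma riesz_q:
  assumes "d \<ge> 1" "\<alpha> \<ge> 0" "\<beta> \<ge> 0" "l > 0" "\<alpha> + \<beta> + l < real d"
    and "p_minus d \<alpha> < p" "p < p_plus d \<alpha> l"
  shows "1 + 1 / riesz_q d \<alpha> \<beta> l p = 1 / p + (\<alpha> + \<beta> + l) / real d"
    and "riesz_q d \<alpha> \<beta> l p > p"
proof -
  define r where "r = 1 / p + (\<alpha> + \<beta> + l) / real d - 1"
  have d: "real d > 0" using assms(1) by simp
  have c: "real d - \<alpha> - l > 0" "real d - \<alpha> > 0" using assms(3-5) by linarith+
  have p: "p > 0"
    using assms(6) c(2) d unfolding p_minus_def
    by (meson divide_pos_pos less_trans)
  have "p * (real d - \<alpha> - l) < real d"
    using assms(7) c(1) unfolding p_plus_def by (simp add: pos_less_divide_eq)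
  then have "(real d - \<alpha> - l) / real d < 1 / p"
    using d p by (simp add: field_simps)
  moreover have "(real d - \<alpha> - l) / real d + (\<alpha> + \<beta> + l) / real d - 1 = \<beta> / real d"
    using d by (simp add: field_simps)
  moreover have "\<beta> / real d \<ge> 0" using assms(3) d by simp
  ultimately have r0: "r > 0" unfolding r_def by linarith
  have "riesz_q d \<alpha> \<beta> l p = 1 / r"
    unfolding riesz_q_def
  proof (rule the_equality)
    show "1 + 1 / (1 / r) = 1 / p + (\<alpha> + \<beta> + l) / real d" by (simp add: r_def)
  next
    fix q assume "1 + 1 / q = 1 / p + (\<alpha> + \<beta> + l) / real d"
    then have "1 / q = r" by (simp add: r_def)
    then show "q = 1 / r" by auto
  qed
  moreover have "r < 1 / p"
    using assms(5) d by (simp add: r_def field_simps)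
  then have "p < 1 / r"
    using r0 p by (simp add: field_simps)
  ultimately show "1 + 1 / riesz_q d \<alpha> \<beta> l p = 1 / p + (\<alpha> + \<beta> + l) / real d"
    and "riesz_q d \<alpha> \<beta> l p > p"
    by (simp_all add: r_def)
qed

end

theory Submission
  imports Defs
begin

text \<open>
  Put \<open>\<epsilon> = d - \<alpha> - d / p\<close> and \<open>\<delta> = l - \<epsilon>\<close>. They vanish exactly at the two ends of the range of \<open>p\<close>,
  and \<open>(p - p_minus) * (p_plus - p)\<close> is comparable to \<open>\<epsilon> * \<delta>\<close>.

  Upper bound, \<open>\<alpha> + \<beta> > 0\<close>: with respect to the measure \<open>norm y powr (- d)\<close> the operator has the kernel
  \<open>norm x powr \<delta> * norm (x - y) powr (- l) * norm y powr \<epsilon>\<close>, homogeneous of degree \<open>0\<close>. Its \<open>L\<^sub>r\<close> norms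
  in either variable, \<open>r = 1 / \<kappa>\<close>, are finite because \<open>r * l < d\<close>, and their \<open>r\<close>-th powers are of order
  \<open>1 / \<epsilon> + 1 / \<delta>\<close>. Young's inequality for such kernels gives the order \<open>(\<epsilon> * \<delta>) powr (- \<kappa>)\<close>.

  Upper bound, \<open>\<alpha> = \<beta> = 0\<close>: now \<open>r * l = d\<close> and the diagonal singularity is critical. A suitable power of
  the potential satisfies a level set estimate of Doob type, which integrates to the sharp order.

  Lower bound: at \<open>\<epsilon> \<rightarrow> 0\<close> the part \<open>norm y < norm x\<close> of the kernel dominates, at \<open>\<delta> \<rightarrow> 0\<close> the part
  \<open>norm y > norm x\<close>. In the variable \<open>ln (norm y)\<close> these parts are convolutions with one-sided exponentials of
  rates \<open>\<epsilon>\<close> and \<open>\<delta>\<close>, so the test functions live on intervals of length of order \<open>1 / \<epsilon>\<close> and \<open>1 / \<delta>\<close>.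
\<close>

section \<open>Powers of the norm\<close>

definition sphere_area :: "'a::euclidean_space itself \<Rightarrow> real" where
  "sphere_area _ = real DIM('a) * unit_ball_vol DIM('a)"

lemma sphere_area_pos: "sphere_area TYPE('a::euclidean_space) > 0"
  by (simp add: sphere_area_def)

text \<open>The half-lines \<open>{..a}\<close> are stable under intersection and generate the Borel
  sets, and both measures give \<open>{..a}\<close> the volume of the ball of radius
  \<open>a\<close>. The volume of balls alone thus reduces radial integrals to the real line,
  without a surface measure on the sphere.\<close>

lemma distr_norm_lborel:
  "distr lborel borel (norm :: 'a::euclidean_space \<Rightarrow> real) =
     density lborel (\<lambda>r. ennreal (sphere_area TYPE('a) * r powr (DIM('a) - 1)) * indicator {0..} r)"
    (is "?L = ?R")
proof (rule measure_eqI_generator_eq[where E="range (\<lambda>a::real. {..a})" and A="\<lambda>n::nat. {..real n}" and \<Omega>=UNIV])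
  show "Int_stable (range (\<lambda>a::real. {..a}))"
    by (auto simp: Int_stable_def)
  show "sets ?L = sigma_sets UNIV (range (\<lambda>a::real. {..a}))"
    by (simp add: borel_eq_atMost)
  show "sets ?R = sigma_sets UNIV (range (\<lambda>a::real. {..a}))"
    by (simp add: borel_eq_atMost)
  have L: "emeasure ?L {..a} = emeasure lborel {x::'a. norm x \<le> a}" for a
    by (subst emeasure_distr) (auto intro!: arg_cong[where f="emeasure lborel"])
  show "emeasure ?L X = emeasure ?R X" if "X \<in> range (\<lambda>a::real. {..a})" for X
  proof -
    from that obtain a where X: "X = {..a}" by auto
    have R: "emeasure ?R X = (\<integral>\<^sup>+r. ennreal (sphere_area TYPE('a) * r powr (DIM('a) - 1)) * indicator {0..} r * indicator {..a} r \<partial>lborel)"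
      unfolding X by (subst emeasure_density) auto
    show ?thesis
    proof (cases "a < 0")
      case True
      have "{x::'a. norm x \<le> a} = {}" using True norm_ge_zero order.trans not_less by blast
      moreover have "emeasure ?R X = (\<integral>\<^sup>+r. 0 \<partial>(lborel::real measure))"
        unfolding R using True by (intro nn_integral_cong) (auto split: split_indicator)
      ultimately show ?thesis using L X by simp
    next
      case False
      then have a: "a \<ge> 0" by simp
      have "((\<lambda>r. sphere_area TYPE('a) * r powr (real DIM('a) - 1)) has_integral
              sphere_area TYPE('a) * (a powr (real DIM('a) - 1 + 1) / (real DIM('a) - 1 + 1))) {0..a}"
        by (intro has_integral_mult_right has_integral_powr_from_0) (use a DIM_positive[where 'a='a] in \<open>auto simp del: DIM_positive\<close>)
      from nn_integral_has_integral_lebesgue'[OF _ this]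
      have "(\<integral>\<^sup>+r. ennreal (sphere_area TYPE('a) * r powr (real DIM('a) - 1)) * indicator {0..a} r \<partial>lborel)
         = ennreal (sphere_area TYPE('a) * (a powr (real DIM('a) - 1 + 1) / (real DIM('a) - 1 + 1)))"
        using sphere_area_pos[where 'a='a] by simp
      also have "sphere_area TYPE('a) * (a powr (real DIM('a) - 1 + 1) / (real DIM('a) - 1 + 1)) = unit_ball_vol DIM('a) * a ^ DIM('a)"
      proof (cases "a = 0")
        case False then show ?thesis using a by (simp add: sphere_area_def powr_realpow)
      qed (simp add: power_0_left)
      also have "(\<integral>\<^sup>+r. ennreal (sphere_area TYPE('a) * r powr (real DIM('a) - 1)) * indicator {0..a} r \<partial>lborel)
         = emeasure ?R X" unfolding R
        by (intro nn_integral_cong) (auto split: split_indicator simp: of_nat_diff DIM_positive Suc_leI)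
      also have "{x::'a. norm x \<le> a} = cball 0 a" by auto
      ultimately show ?thesis using L X emeasure_cball[OF a, of "0::'a"] \<open>{x::'a. norm x \<le> a} = cball 0 a\<close> by simp
    qed
  qed
  show "emeasure ?L {..real n} \<noteq> \<infinity>" for n
  proof -
    have "{x::'a. norm x \<le> real n} = cball 0 (real n)" by auto
    then show ?thesis using L emeasure_lborel_cball_finite[of "0::'a" "real n"] by simp
  qed
  show "(\<Union>n::nat. {..real n}) = UNIV" using real_arch_simple by auto
qed auto

lemma nn_integral_norm:
  assumes [measurable]: "g \<in> borel_measurable borel"
  shows "(\<integral>\<^sup>+x. g (norm (x::'a::euclidean_space)) \<partial>lborel) =
    (\<integral>\<^sup>+r. ennreal (sphere_area TYPE('a) * r powr (DIM('a) - 1)) * indicator {0..} r * g r \<partial>lborel)"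
proof -
  have "(\<integral>\<^sup>+x. g (norm (x::'a)) \<partial>lborel) = (\<integral>\<^sup>+r. g r \<partial>distr lborel borel (norm :: 'a \<Rightarrow> real))"
    by (subst nn_integral_distr) auto
  then show ?thesis unfolding distr_norm_lborel by (simp add: nn_integral_density)
qed

text \<open>One reduction covers balls, exteriors and annuli: the radial density merges with the
  power of the norm, and only the one-dimensional integral over the set \<open>S\<close> of radii
  changes.\<close>

lemma nn_integral_powr_norm_on:
  fixes S :: "real set" and e I :: real
  assumes S: "S \<subseteq> {0..}" "S \<in> sets borel"
    and I: "((\<lambda>r. r powr (e + DIM('a) - 1)) has_integral I) S"
  shows "(\<integral>\<^sup>+x. ennreal (norm (x::'a::euclidean_space) powr e) * indicator {x. norm x \<in> S} x \<partial>lborel)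
    = ennreal (sphere_area TYPE('a) * I)"
proof -
  note [measurable] = S(2)
  have "(\<integral>\<^sup>+x. ennreal (norm (x::'a) powr e) * indicator {x. norm x \<in> S} x \<partial>lborel)
      = (\<integral>\<^sup>+x. (\<lambda>r. ennreal (r powr e) * indicator S r) (norm (x::'a)) \<partial>lborel)"
    by (intro nn_integral_cong) (auto split: split_indicator)
  also have "\<dots> = (\<integral>\<^sup>+r. ennreal (sphere_area TYPE('a) * r powr (e + DIM('a) - 1)) * indicator S r \<partial>lborel)"
  proof (subst nn_integral_norm, measurable, rule nn_integral_cong)
    fix r :: real
    have "r powr (real DIM('a) - 1) * r powr e = r powr (e + DIM('a) - 1)"
      by (simp add: powr_add[symmetric] algebra_simps)
    then show "ennreal (sphere_area TYPE('a) * r powr (DIM('a) - 1)) * indicator {0..} r * (ennreal (r powr e) * indicator S r)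
      = ennreal (sphere_area TYPE('a) * r powr (e + DIM('a) - 1)) * indicator S r"
      using S(1) sphere_area_pos[where 'a='a]
      by (auto split: split_indicator simp: ennreal_mult'[symmetric] of_nat_diff DIM_positive Suc_leI mult.assoc)
  qed
  also have "\<dots> = ennreal (sphere_area TYPE('a) * I)"
    using has_integral_mult_right[OF I, of "sphere_area TYPE('a)"] sphere_area_pos[where 'a='a]
    by (intro nn_integral_has_integral_lebesgue') (auto simp: less_imp_le)
  finally show ?thesis .
qed

text \<open>With the exponent written as \<open>s - d\<close> the radial integrand is
  \<open>r powr (s - 1)\<close>, so \<open>s > 0\<close> is exactly integrability at the
  origin.\<close>

lemma nn_integral_powr_norm_ball:
  fixes s R :: real
  assumes "s > 0" "R \<ge> 0"
  shows "(\<integral>\<^sup>+x. ennreal (norm (x::'a::euclidean_space) powr (s - DIM('a))) * indicator {x. norm x \<le> R} x \<partial>lborel)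
    = ennreal (sphere_area TYPE('a) / s * R powr s)"
proof -
  have "((\<lambda>r. r powr (s - DIM('a) + DIM('a) - 1)) has_integral R powr (s - 1 + 1) / (s - 1 + 1)) {0..R}"
    using has_integral_powr_from_0[of "s - 1" R] assms by simp
  from nn_integral_powr_norm_on[OF _ _ this] show ?thesis by simp
qed

lemma nn_integral_powr_norm_tail:
  fixes s R :: real
  assumes "s > 0" "R > 0"
  shows "(\<integral>\<^sup>+x. ennreal (norm (x::'a::euclidean_space) powr (- s - DIM('a))) * indicator {x. R \<le> norm x} x \<partial>lborel)
    = ennreal (sphere_area TYPE('a) / s * R powr (- s))"
proof -
  have "((\<lambda>r. r powr (- s - DIM('a) + DIM('a) - 1)) has_integral - (R powr (- s - 1 + 1)) / (- s - 1 + 1)) {R..}"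
    using has_integral_powr_to_inf[of "- s - 1" R] assms by simp
  from nn_integral_powr_norm_on[OF _ _ this] show ?thesis using assms by simp
qed

text \<open>The critical exponent \<open>- d\<close> turns the radial measure into dr / r, so the
  mass of an annulus is proportional to its logarithmic width. The test functions of the lower bound
  are measured by this dilation-invariant mass.\<close>

lemma nn_integral_powr_norm_annulus:
  fixes a b :: real
  assumes "0 < a" "a \<le> b"
  shows "(\<integral>\<^sup>+x. ennreal (norm (x::'a::euclidean_space) powr (- real DIM('a))) * indicator {x. a \<le> norm x \<and> norm x \<le> b} x \<partial>lborel)
    = ennreal (sphere_area TYPE('a) * (ln b - ln a))"
proof -
  have "((\<lambda>r. r powr (- real DIM('a) + DIM('a) - 1)) has_integral ln b - ln a) {a..b}"
  proof (rule fundamental_theorem_of_calculus[OF assms(2)])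
    fix x assume "x \<in> {a..b}"
    then have "x > 0" using assms by auto
    then show "(ln has_vector_derivative x powr (- real DIM('a) + DIM('a) - 1)) (at x within {a..b})"
      unfolding has_real_derivative_iff_has_vector_derivative[symmetric]
      by (auto intro!: derivative_eq_intros simp: powr_minus divide_simps)
  qed
  from nn_integral_powr_norm_on[OF _ _ this] show ?thesis using assms by simp
qed

lemma nn_integral_diff_lborel:
  fixes x :: "'a::euclidean_space"
  assumes [measurable]: "h \<in> borel_measurable borel"
  shows "(\<integral>\<^sup>+y. h (x - y) \<partial>lborel) = (\<integral>\<^sup>+y. h y \<partial>lborel)"
proof -
  have "(\<integral>\<^sup>+y. h y \<partial>lborel) = (\<integral>\<^sup>+y. h y \<partial>density (distr lborel borel (\<lambda>y. x + (-1) *\<^sub>R y)) (\<lambda>_. ennreal (\<bar>-1\<bar>^DIM('a))))"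
    using lborel_affine[of "-1" x] by (simp add: ennreal_power[symmetric])
  also have "\<dots> = (\<integral>\<^sup>+y. h (x - y) \<partial>lborel)"
    by (simp add: nn_integral_density nn_integral_distr)
  finally show ?thesis ..
qed

section \<open>Integral inequalities\<close>

text \<open>After division by \<open>U\<close> and \<open>V\<close> this is the inequality between
  weighted geometric and arithmetic means, integrated. The functions enter already raised to their
  Hoelder powers, and \<open>t\<close>, \<open>1 - t\<close> are the reciprocal exponents. If
  \<open>U\<close> or \<open>V\<close> is 0, one function vanishes almost everywhere, and so does
  the product.\<close>

lemma nn_integral_Holder:
  fixes a b :: "'a \<Rightarrow> real"
  assumes [measurable]: "a \<in> borel_measurable M" "b \<in> borel_measurable M"
    and nn: "\<And>x. a x \<ge> 0" "\<And>x. b x \<ge> 0"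
    and t: "0 < t" "t < 1" and UV: "U \<ge> 0" "V \<ge> 0"
    and U: "(\<integral>\<^sup>+x. ennreal (a x) \<partial>M) \<le> ennreal U" and V: "(\<integral>\<^sup>+x. ennreal (b x) \<partial>M) \<le> ennreal V"
  shows "(\<integral>\<^sup>+x. ennreal (a x powr t * b x powr (1 - t)) \<partial>M) \<le> ennreal (U powr t * V powr (1 - t))"
proof (cases "U = 0 \<or> V = 0")
  case True
  then have "(AE x in M. a x = 0) \<or> (AE x in M. b x = 0)"
    using U V nn by (auto simp: nn_integral_0_iff_AE)
  then have "AE x in M. ennreal (a x powr t * b x powr (1 - t)) = 0"
  proof
    assume "AE x in M. a x = 0"
    then show ?thesis by eventually_elim simp
  next
    assume "AE x in M. b x = 0"
    then show ?thesis by eventually_elim simp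
  qed
  then have "(\<integral>\<^sup>+x. ennreal (a x powr t * b x powr (1 - t)) \<partial>M) = 0"
    by (subst nn_integral_0_iff_AE) auto
  then show ?thesis by simp
next
  case False
  then have UV: "U > 0" "V > 0" using UV by auto
  define C where "C = U powr t * V powr (1 - t)"
  have C: "C \<ge> 0" by (simp add: C_def)
  have le: "a x powr t * b x powr (1 - t) \<le> C * (t / U) * a x + C * ((1 - t) / V) * b x" for x
  proof (cases "a x = 0 \<or> b x = 0")
    case True then show ?thesis using nn[of x] t UV C by auto
  next
    case False
    then have ab: "a x > 0" "b x > 0" using nn[of x] by (auto simp: less_le)
    have "a x powr t * b x powr (1 - t) = C * ((a x / U) powr t * (b x / V) powr (1 - t))"
      using UV ab by (simp add: C_def powr_divide)
    also have "\<dots> \<le> C * (t * (a x / U) + (1 - t) * (b x / V))"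
      using ab UV t C by (intro mult_left_mono Youngs_inequality_0) auto
    finally show ?thesis by (simp add: algebra_simps)
  qed
  have "(\<integral>\<^sup>+x. ennreal (a x powr t * b x powr (1 - t)) \<partial>M)
      \<le> (\<integral>\<^sup>+x. ennreal (C * (t / U)) * ennreal (a x) + ennreal (C * ((1 - t) / V)) * ennreal (b x) \<partial>M)"
    using C t UV nn by (intro nn_integral_mono order.trans[OF ennreal_leI[OF le]])
      (simp add: ennreal_mult'[symmetric] ennreal_plus[symmetric] del: ennreal_plus)
  also have "\<dots> = ennreal (C * (t / U)) * (\<integral>\<^sup>+x. ennreal (a x) \<partial>M) + ennreal (C * ((1 - t) / V)) * (\<integral>\<^sup>+x. ennreal (b x) \<partial>M)"
    by (simp add: nn_integral_add nn_integral_cmult)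
  also have "\<dots> \<le> ennreal (C * (t / U)) * ennreal U + ennreal (C * ((1 - t) / V)) * ennreal V"
    by (intro add_mono mult_left_mono U V) auto
  also have "\<dots> = ennreal (C * (t / U) * U + C * ((1 - t) / V) * V)"
    using UV C t by (simp add: ennreal_mult'[symmetric] ennreal_plus[symmetric] del: ennreal_plus)
  also have "C * (t / U) * U + C * ((1 - t) / V) * V = C" using UV by (simp add: field_simps)
  finally show ?thesis unfolding C_def .
qed

text \<open>The factorisation behind Young's inequality: the outer exponents \<open>1 / q\<close>,
  \<open>1 - 1 / p\<close>, \<open>1 - 1 / r\<close> add up to 1, as a three-factor Hoelder
  inequality demands, and the total exponents of \<open>k\<close> and of \<open>g\<close> are both
  1.\<close>

lemma powr_eq_powr_mult_powr:
  fixes k g :: real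
  assumes "k \<ge> 0" "g \<ge> 0" and "1 + 1 / q = 1 / p + 1 / r" "p > 0" "q > 0" "r > 0"
  shows "k * g = (k powr r * g powr p) powr (1 / q) * ((k powr r) powr (1 - 1 / p) * (g powr p) powr (1 - 1 / r))"
proof (cases "k = 0 \<or> g = 0")
  case False
  then have kg: "k > 0" "g > 0" using assms by auto
  have e: "r * (1 / q) + r * (1 - 1 / p) = 1" "p * (1 / q) + p * (1 - 1 / r) = 1"
    using assms by (auto simp: field_simps)
  have "(k powr r * g powr p) powr (1 / q) * ((k powr r) powr (1 - 1 / p) * (g powr p) powr (1 - 1 / r))
    = k powr (r * (1 / q) + r * (1 - 1 / p)) * g powr (p * (1 / q) + p * (1 - 1 / r))"
    using kg by (simp add: powr_mult powr_powr powr_add)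
  then show ?thesis using kg unfolding e by simp
qed auto

text \<open>Hoelder's inequality for the three factors of \<open>K x y * g y\<close> bounds the
  image at \<open>x\<close> by \<open>u x powr (1 / q) * A powr (1 - 1 / p)\<close>, using the row
  bound and the normalisation of \<open>g\<close>. The column bound and Tonelli give that
  \<open>u\<close> has integral at most \<open>A\<close>; raising to the power \<open>q\<close> and
  integrating yields \<open>A powr (1 / r)\<close>. Finiteness almost everywhere is a separate claim
  because \<open>enn2real\<close> sends infinity to 0.\<close>

lemma Young_kernel:
  fixes K :: "'a \<Rightarrow> 'b \<Rightarrow> real" and g :: "'b \<Rightarrow> real"
  assumes sf: "sigma_finite_measure M" "sigma_finite_measure N"
    and [measurable]: "case_prod K \<in> borel_measurable (M \<Otimes>\<^sub>M N)" "g \<in> borel_measurable N"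
    and nn: "\<And>x y. K x y \<ge> 0" "\<And>y. g y \<ge> 0"
    and pqr: "1 + 1 / q = 1 / p + 1 / r" "p > 1" "q > 1" "r > 1" and A: "A \<ge> 0"
    and row: "AE x in M. (\<integral>\<^sup>+y. ennreal (K x y powr r) \<partial>N) \<le> ennreal A"
    and col: "AE y in N. (\<integral>\<^sup>+x. ennreal (K x y powr r) \<partial>M) \<le> ennreal A"
    and g1: "(\<integral>\<^sup>+y. ennreal (g y powr p) \<partial>N) \<le> 1"
  shows "AE x in M. (\<integral>\<^sup>+y. ennreal (K x y * g y) \<partial>N) < \<infinity>"
    and "(\<integral>\<^sup>+x. ennreal (enn2real (\<integral>\<^sup>+y. ennreal (K x y * g y) \<partial>N) powr q) \<partial>M)
      \<le> ennreal ((A powr (1 / r)) powr q)"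
proof -
  interpret M: sigma_finite_measure M by fact
  interpret N: sigma_finite_measure N by fact
  interpret P: pair_sigma_finite M N ..
  define u where "u x = (\<integral>\<^sup>+y. ennreal (K x y powr r * g y powr p) \<partial>N)" for x
  have [measurable]: "u \<in> borel_measurable M" unfolding u_def by measurable
  have "(\<integral>\<^sup>+x. u x \<partial>M) = (\<integral>\<^sup>+y. (\<integral>\<^sup>+x. ennreal (K x y powr r * g y powr p) \<partial>M) \<partial>N)"
    unfolding u_def by (rule P.Fubini'[symmetric]) simp
  also have "\<dots> = (\<integral>\<^sup>+y. ennreal (g y powr p) * (\<integral>\<^sup>+x. ennreal (K x y powr r) \<partial>M) \<partial>N)"
    by (intro nn_integral_cong) (simp add: nn_integral_cmult[symmetric] ennreal_mult'[symmetric] mult.commute)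
  also have "\<dots> \<le> (\<integral>\<^sup>+y. ennreal (g y powr p) * ennreal A \<partial>N)"
  proof (rule nn_integral_mono_AE)
    show "AE y in N. ennreal (g y powr p) * (\<integral>\<^sup>+x. ennreal (K x y powr r) \<partial>M) \<le> ennreal (g y powr p) * ennreal A"
      using col by eventually_elim (intro mult_left_mono, auto)
  qed
  also have "\<dots> = ennreal A * (\<integral>\<^sup>+y. ennreal (g y powr p) \<partial>N)"
    by (subst nn_integral_multc) (simp_all add: mult.commute)
  also have "\<dots> \<le> ennreal A * 1" by (intro mult_left_mono g1) simp
  finally have u: "(\<integral>\<^sup>+x. u x \<partial>M) \<le> ennreal A" by simp
  then have "(\<integral>\<^sup>+x. u x \<partial>M) \<noteq> \<infinity>" by (auto simp: top_unique)
  then have ufin: "AE x in M. u x \<noteq> \<infinity>" by (intro nn_integral_noteq_infinite) auto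
  have e: "0 < 1 / q" "1 / q < 1" "0 < 1 - 1 / p" "0 < 1 - 1 / r"
    using pqr(2-4) by auto
  have e6: "(1 - 1 / p) + (1 - 1 / r) = 1 - 1 / q" using pqr(1) by linarith
  have bnd: "(\<integral>\<^sup>+y. ennreal (K x y * g y) \<partial>N) \<le> ennreal (enn2real (u x) powr (1 / q) * A powr (1 - 1 / p))"
    if x: "x \<in> space M" "u x \<noteq> \<infinity>" "(\<integral>\<^sup>+y. ennreal (K x y powr r) \<partial>N) \<le> ennreal A" for x
  proof -
    have [measurable]: "K x \<in> borel_measurable N" using x(1) by measurable
    \<comment> \<open>Three-factor Hoelder is obtained from two two-factor ones. The factors with
      exponents \<open>1 - 1 / p\<close> and \<open>1 - 1 / r\<close> are merged into
      \<open>b\<close> with total exponent \<open>1 - 1 / q\<close>, and \<open>s\<close> is the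
      share of the first in that total.\<close>
    define s where "s = (1 - 1 / p) / (1 - 1 / q)"
    have s: "0 < s" "s < 1" "s * (1 - 1 / q) = 1 - 1 / p" "(1 - s) * (1 - 1 / q) = 1 - 1 / r"
    proof -
      have q: "1 - 1 / q > 0" using e by simp
      show "0 < s" "s < 1" using e e6 q by (simp_all add: s_def)
      show s1: "s * (1 - 1 / q) = 1 - 1 / p" unfolding s_def using q by (intro nonzero_eq_divide_eq[THEN iffD1]) auto
      then show "(1 - s) * (1 - 1 / q) = 1 - 1 / r" using e6 by (simp add: left_diff_distrib)
    qed
    define b where "b y = (K x y powr r) powr s * (g y powr p) powr (1 - s)" for y
    have "(\<integral>\<^sup>+y. ennreal (b y) \<partial>N) \<le> ennreal (A powr s * 1 powr (1 - s))"
      unfolding b_def using x(3) g1 s A by (intro nn_integral_Holder) auto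
    then have b: "(\<integral>\<^sup>+y. ennreal (b y) \<partial>N) \<le> ennreal (A powr s)" by simp
    have "(\<integral>\<^sup>+y. ennreal ((K x y powr r * g y powr p) powr (1 / q) * b y powr (1 - 1 / q)) \<partial>N)
       \<le> ennreal (enn2real (u x) powr (1 / q) * (A powr s) powr (1 - 1 / q))"
      using x(2) e b unfolding u_def
      by (intro nn_integral_Holder) (auto simp: b_def less_top)
    also have "(\<lambda>y. (K x y powr r * g y powr p) powr (1 / q) * b y powr (1 - 1 / q)) = (\<lambda>y. K x y * g y)"
    proof
      fix y
      have "b y powr (1 - 1 / q) = (K x y powr r) powr (1 - 1 / p) * (g y powr p) powr (1 - 1 / r)"
        unfolding b_def by (simp only: powr_mult powr_powr[of _ s] powr_powr[of _ "1 - s"] s powr_ge_zero)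
      then show "(K x y powr r * g y powr p) powr (1 / q) * b y powr (1 - 1 / q) = K x y * g y"
        using powr_eq_powr_mult_powr[of "K x y" "g y" q p r] nn pqr by simp
    qed
    also have "(A powr s) powr (1 - 1 / q) = A powr (1 - 1 / p)" by (simp only: powr_powr s)
    finally show ?thesis .
  qed
  have "AE x in M. (\<integral>\<^sup>+y. ennreal (K x y * g y) \<partial>N) \<le> ennreal (enn2real (u x) powr (1 / q) * A powr (1 - 1 / p))"
    using ufin row AE_space
  proof eventually_elim
    case (elim x)
    show ?case by (rule bnd) (use elim in auto)
  qed
  note bnd = this
  then show "AE x in M. (\<integral>\<^sup>+y. ennreal (K x y * g y) \<partial>N) < \<infinity>"
    by eventually_elim (auto intro: le_less_trans)
  have "(\<integral>\<^sup>+x. ennreal (enn2real (\<integral>\<^sup>+y. ennreal (K x y * g y) \<partial>N) powr q) \<partial>M)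
    \<le> (\<integral>\<^sup>+x. ennreal (A powr ((1 - 1 / p) * q)) * u x \<partial>M)"
  proof (rule nn_integral_mono_AE)
    show "AE x in M. ennreal (enn2real (\<integral>\<^sup>+y. ennreal (K x y * g y) \<partial>N) powr q) \<le> ennreal (A powr ((1 - 1 / p) * q)) * u x"
      using bnd ufin
    proof eventually_elim
      case (elim x)
      have "enn2real (\<integral>\<^sup>+y. ennreal (K x y * g y) \<partial>N) \<le> enn2real (u x) powr (1 / q) * A powr (1 - 1 / p)"
        using elim(1) by (intro enn2real_leI) auto
      then have "enn2real (\<integral>\<^sup>+y. ennreal (K x y * g y) \<partial>N) powr q \<le> (enn2real (u x) powr (1 / q) * A powr (1 - 1 / p)) powr q"
        using pqr by (intro powr_mono2) auto
      also have "\<dots> = A powr ((1 - 1 / p) * q) * enn2real (u x)"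
        using pqr by (simp add: powr_mult powr_powr)
      finally have "ennreal (enn2real (\<integral>\<^sup>+y. ennreal (K x y * g y) \<partial>N) powr q) \<le> ennreal (A powr ((1 - 1 / p) * q) * enn2real (u x))"
        by (rule ennreal_leI)
      also have "\<dots> = ennreal (A powr ((1 - 1 / p) * q)) * u x"
        using elim(2) by (simp add: ennreal_mult' less_top)
      finally show ?case .
    qed
  qed
  also have "\<dots> = ennreal (A powr ((1 - 1 / p) * q)) * (\<integral>\<^sup>+x. u x \<partial>M)" by (simp add: nn_integral_cmult)
  also have "\<dots> \<le> ennreal (A powr ((1 - 1 / p) * q)) * ennreal A" by (intro mult_left_mono u) simp
  also have "\<dots> = ennreal (A powr ((1 - 1 / p) * q) * A powr 1)" using A by (simp add: ennreal_mult')
  also have "\<dots> = ennreal ((A powr (1 / r)) powr q)"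
  proof -
    have "(1 - 1 / p) * q + 1 = 1 / r * q" using pqr by (simp add: field_simps)
    then show ?thesis by (simp only: powr_add[symmetric] powr_powr)
  qed
  finally show "(\<integral>\<^sup>+x. ennreal (enn2real (\<integral>\<^sup>+y. ennreal (K x y * g y) \<partial>N) powr q) \<partial>M)
      \<le> ennreal ((A powr (1 / r)) powr q)" .
qed

section \<open>From level set estimates to norms\<close>

lemma nn_integral_powr_0_to:
  assumes "a > (-1::real)" "c \<ge> 0"
  shows "(\<integral>\<^sup>+t. ennreal (t powr a) * indicator {0..c} t \<partial>lborel) = ennreal (c powr (a + 1) / (a + 1))"
  using has_integral_powr_from_0[OF assms] by (intro nn_integral_has_integral_lebesgue') auto

text \<open>The weak estimate is multiplied by \<open>p * t powr (p - 1)\<close> and integrated over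
  \<open>t\<close>, with Tonelli on both sides; the factor \<open>1 / t\<close> lowers the power to
  \<open>p - 2\<close>, which integrates over \<open>{0..g y}\<close> to
  \<open>g y powr (p - 1) / (p - 1)\<close>. Since the truncation is at the level of
  \<open>g\<close> itself and not of \<open>u\<close>, no further Hoelder step is involved and the
  constant is \<open>p / (p - 1)\<close> without a power.\<close>

lemma layer_cake_weak_to_strong:
  fixes u :: "'a \<Rightarrow> real" and g :: "'b \<Rightarrow> real"
  assumes sf: "sigma_finite_measure M" "sigma_finite_measure N"
    and [measurable]: "u \<in> borel_measurable M" "g \<in> borel_measurable N"
    and nn: "\<And>x. u x \<ge> 0" "\<And>y. g y \<ge> 0" and p: "p > 1"
    and weak: "\<And>t. t > 0 \<Longrightarrow> emeasure M {x \<in> space M. t \<le> u x}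
      \<le> ennreal (1 / t) * (\<integral>\<^sup>+y. ennreal (g y) * indicator {y. t \<le> g y} y \<partial>N)"
  shows "(\<integral>\<^sup>+x. ennreal (u x powr p) \<partial>M) \<le> ennreal (p / (p - 1)) * (\<integral>\<^sup>+y. ennreal (g y powr p) \<partial>N)"
proof -
  interpret M: sigma_finite_measure M by fact
  interpret N: sigma_finite_measure N by fact
  interpret PM: pair_sigma_finite M "lborel :: real measure" ..
  interpret PN: pair_sigma_finite N "lborel :: real measure" ..
  have "ennreal (u x powr p) = (\<integral>\<^sup>+t. ennreal (p * t powr (p - 1)) * indicator {0..u x} t \<partial>lborel)" for x
  proof -
    have "(\<integral>\<^sup>+t. ennreal (p * t powr (p - 1)) * indicator {0..u x} t \<partial>lborel)
       = ennreal p * (\<integral>\<^sup>+t. ennreal (t powr (p - 1)) * indicator {0..u x} t \<partial>lborel)"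
      using p by (subst nn_integral_cmult[symmetric]) (auto simp: ennreal_mult' mult.assoc)
    also have "\<dots> = ennreal (u x powr p)"
      using p nn by (subst nn_integral_powr_0_to) (auto simp: ennreal_mult'[symmetric])
    finally show ?thesis ..
  qed
  then have "(\<integral>\<^sup>+x. ennreal (u x powr p) \<partial>M) = (\<integral>\<^sup>+x. (\<integral>\<^sup>+t. ennreal (p * t powr (p - 1)) * indicator {0..u x} t \<partial>lborel) \<partial>M)"
    by simp
  also have "\<dots> = (\<integral>\<^sup>+t. (\<integral>\<^sup>+x. ennreal (p * t powr (p - 1)) * indicator {0..u x} t \<partial>M) \<partial>lborel)"
    unfolding indicator_def atLeastAtMost_iff by (rule PM.Fubini'[symmetric]) measurable
  also have "\<dots> \<le> (\<integral>\<^sup>+t. (\<integral>\<^sup>+y. ennreal (g y) * (ennreal (p * t powr (p - 2)) * indicator {0..g y} t) \<partial>N) \<partial>lborel)"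
  proof (rule nn_integral_mono)
    fix t :: real
    show "(\<integral>\<^sup>+x. ennreal (p * t powr (p - 1)) * indicator {0..u x} t \<partial>M)
       \<le> (\<integral>\<^sup>+y. ennreal (g y) * (ennreal (p * t powr (p - 2)) * indicator {0..g y} t) \<partial>N)"
    proof (cases "t > 0")
      case False
      then have "(\<integral>\<^sup>+x. ennreal (p * t powr (p - 1)) * indicator {0..u x} t \<partial>M) = (\<integral>\<^sup>+x. 0 \<partial>M)"
        by (intro nn_integral_cong) (auto split: split_indicator simp: not_less)
      then show ?thesis by simp
    next
      case True
      have "(\<integral>\<^sup>+x. ennreal (p * t powr (p - 1)) * indicator {0..u x} t \<partial>M)
        = (\<integral>\<^sup>+x. ennreal (p * t powr (p - 1)) * indicator {x \<in> space M. t \<le> u x} x \<partial>M)"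
        using True by (intro nn_integral_cong) (auto split: split_indicator)
      also have "\<dots> = ennreal (p * t powr (p - 1)) * emeasure M {x \<in> space M. t \<le> u x}"
        by (simp add: nn_integral_cmult_indicator)
      also have "\<dots> \<le> ennreal (p * t powr (p - 1)) * (ennreal (1 / t) * (\<integral>\<^sup>+y. ennreal (g y) * indicator {y. t \<le> g y} y \<partial>N))"
        by (intro mult_left_mono weak True) simp
      also have "\<dots> = ennreal (p * t powr (p - 2)) * (\<integral>\<^sup>+y. ennreal (g y) * indicator {y. t \<le> g y} y \<partial>N)"
      proof -
        have "t powr (p - 1) = t powr (p - 2) * t powr 1" by (simp only: powr_add[symmetric]) simp
        then have "p * t powr (p - 1) * (1 / t) = p * t powr (p - 2)" using True by simp
        moreover have "ennreal (p * t powr (p - 1)) * ennreal (1 / t) = ennreal (p * t powr (p - 1) * (1 / t))"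
          using True by (intro ennreal_mult''[symmetric]) simp
        ultimately show ?thesis by (simp only: mult.assoc[symmetric])
      qed
      also have "\<dots> = (\<integral>\<^sup>+y. ennreal (g y) * (ennreal (p * t powr (p - 2)) * indicator {0..g y} t) \<partial>N)"
        using True by (subst nn_integral_cmult[symmetric])
          (auto intro!: nn_integral_cong split: split_indicator simp: mult.commute)
      finally show ?thesis .
    qed
  qed
  also have "\<dots> = (\<integral>\<^sup>+y. (\<integral>\<^sup>+t. ennreal (g y) * (ennreal (p * t powr (p - 2)) * indicator {0..g y} t) \<partial>lborel) \<partial>N)"
    unfolding indicator_def atLeastAtMost_iff by (rule PN.Fubini') measurable
  also have "\<dots> = (\<integral>\<^sup>+y. ennreal (p / (p - 1)) * ennreal (g y powr p) \<partial>N)"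
  proof (rule nn_integral_cong)
    fix y
    have "(\<integral>\<^sup>+t. ennreal (g y) * (ennreal (p * t powr (p - 2)) * indicator {0..g y} t) \<partial>lborel)
      = ennreal (g y * p) * (\<integral>\<^sup>+t. ennreal (t powr (p - 2)) * indicator {0..g y} t \<partial>lborel)"
      using p nn by (subst nn_integral_cmult[symmetric]) (auto simp: ennreal_mult' mult.assoc intro!: nn_integral_cong)
    also have "\<dots> = ennreal (g y * p * (g y powr (p - 1) / (p - 1)))"
      using p nn nn_integral_powr_0_to[of "p - 2" "g y"] by (simp add: ennreal_mult'[symmetric])
    also have "g y * p * (g y powr (p - 1) / (p - 1)) = p / (p - 1) * g y powr p"
    proof -
      have "g y powr p = g y powr (p - 1) * g y powr 1" by (simp only: powr_add[symmetric]) simp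
      then show ?thesis using nn(2)[of y] by simp
    qed
    finally show "(\<integral>\<^sup>+t. ennreal (g y) * (ennreal (p * t powr (p - 2)) * indicator {0..g y} t) \<partial>lborel)
      = ennreal (p / (p - 1)) * ennreal (g y powr p)" by (simp add: ennreal_mult''[symmetric])
  qed
  also have "\<dots> = ennreal (p / (p - 1)) * (\<integral>\<^sup>+y. ennreal (g y powr p) \<partial>N)" by (simp add: nn_integral_cmult)
  finally show ?thesis .
qed

section \<open>Weighted upper bound\<close>

text \<open>Here \<open>X\<close>, \<open>n\<close>, \<open>D\<close> stand for the norms of
  \<open>x\<close>, \<open>y\<close>, \<open>x - y\<close>, and the triangle inequalities are all
  that is kept of the geometry. If \<open>n \<le> X / 2\<close>, then \<open>D\<close> is at least
  \<open>X / 2\<close>; if \<open>n \<ge> 2 * X\<close>, then \<open>D\<close> is at least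
  \<open>n / 2\<close>; otherwise \<open>n\<close> is comparable to \<open>X\<close> and
  \<open>D\<close> is below \<open>3 * X\<close>, so only the singularity in \<open>D\<close>
  remains. The summands are nonnegative, so their supports may overlap.\<close>

lemma homogeneous_kernel_pointwise:
  fixes X n D :: real
  assumes X: "X > 0" "n \<ge> 0" "D \<ge> 0" "X \<le> D + n" "n \<le> D + X" "D \<le> X + n"
    and r: "r > 0" and ed: "\<epsilon> > 0" "\<delta> > 0" "\<epsilon> + \<delta> = l" and d: "d \<ge> 0"
  shows "(X powr \<delta> * D powr (- l) * n powr \<epsilon>) powr r * n powr (- d) \<le>
     2 powr (r * l) * X powr (- (r * \<epsilon>)) * (n powr (r * \<epsilon> - d) * indicator {..X} n)
   + 2 powr (r * l) * X powr (r * \<delta>) * (n powr (- (r * \<delta>) - d) * indicator {X..} n)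
   + 2 powr (r * l + d) * X powr (r * l - d) * (D powr (- (r * l)) * indicator {..3 * X} D)" (is "?L \<le> ?F1 + ?F2 + ?F3")
proof (cases "n = 0 \<or> D = 0")
  case True
  then have "?L = 0" by auto
  moreover have "?F1 + ?F2 + ?F3 \<ge> 0" by simp
  ultimately show ?thesis by linarith
next
  case False
  then have n: "n > 0" "D > 0" using X by auto
  have l: "l = \<epsilon> + \<delta>" using ed by simp
  have L: "?L = X powr (r * \<delta>) * D powr (- (r * l)) * n powr (r * \<epsilon> - d)"
  proof -
    have "n powr (r * \<epsilon> - d) = n powr (r * \<epsilon>) * n powr (- d)" by (simp add: powr_add[symmetric])
    moreover have "?L = X powr (\<delta> * r) * D powr (- l * r) * n powr (\<epsilon> * r) * n powr (- d)"
      by (simp only: powr_mult powr_powr)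
    ultimately show ?thesis by (simp add: mult_ac)
  qed
  have Fnn: "?F1 \<ge> 0" "?F2 \<ge> 0" "?F3 \<ge> 0" by auto
  have half: "(Y / 2) powr (- (r * l)) = 2 powr (r * l) * Y powr (- (r * l))" if "Y > 0" for Y
    using that by (simp add: powr_divide powr_minus divide_simps)
  consider "n \<le> X / 2" | "2 * X \<le> n" | "X / 2 < n" "n < 2 * X" by linarith
  then show ?thesis
  proof cases
    case 1
    then have "D powr (- (r * l)) \<le> (X / 2) powr (- (r * l))"
      using X r ed by (intro powr_mono2') auto
    then have "?L \<le> X powr (r * \<delta>) * (2 powr (r * l) * X powr (- (r * l))) * n powr (r * \<epsilon> - d)"
      unfolding L half[OF X(1)] by (intro mult_right_mono mult_left_mono) auto
    also have "\<dots> = 2 powr (r * l) * (X powr (r * \<delta>) * X powr (- (r * l))) * n powr (r * \<epsilon> - d)" by simp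
    also have "X powr (r * \<delta>) * X powr (- (r * l)) = X powr (- (r * \<epsilon>))"
      unfolding l by (simp add: powr_add[symmetric] algebra_simps)
    also have "2 powr (r * l) * X powr (- (r * \<epsilon>)) * n powr (r * \<epsilon> - d) = ?F1" using 1 X by simp
    finally show ?thesis using Fnn by linarith
  next
    case 2
    then have "D powr (- (r * l)) \<le> (n / 2) powr (- (r * l))"
      using X n r ed by (intro powr_mono2') auto
    then have "?L \<le> X powr (r * \<delta>) * (2 powr (r * l) * n powr (- (r * l))) * n powr (r * \<epsilon> - d)"
      unfolding L half[OF n(1)] by (intro mult_right_mono mult_left_mono) auto
    also have "\<dots> = 2 powr (r * l) * X powr (r * \<delta>) * (n powr (- (r * l)) * n powr (r * \<epsilon> - d))" by simp
    also have "n powr (- (r * l)) * n powr (r * \<epsilon> - d) = n powr (- (r * \<delta>) - d)"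
    proof -
      have "- (r * l) + (r * \<epsilon> - d) = - (r * \<delta>) - d" unfolding l by (simp add: algebra_simps)
      then show ?thesis by (simp only: powr_add[symmetric])
    qed
    also have "2 powr (r * l) * X powr (r * \<delta>) * n powr (- (r * \<delta>) - d) = ?F2" using 2 X by simp
    finally show ?thesis using Fnn by linarith
  next
    case 3
    have "n powr (r * \<epsilon> - d) = n powr (r * \<epsilon>) * n powr (- d)" by (simp add: powr_add[symmetric])
    also have "\<dots> \<le> (2 * X) powr (r * \<epsilon>) * (X / 2) powr (- d)"
      using 3 X n r ed d by (intro mult_mono powr_mono2 powr_mono2') auto
    also have "\<dots> = 2 powr (r * \<epsilon> + d) * X powr (r * \<epsilon> - d)"
      using X by (simp add: powr_mult powr_divide powr_add powr_minus powr_diff divide_simps)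
    also have "\<dots> \<le> 2 powr (r * l + d) * X powr (r * \<epsilon> - d)"
      using r ed by (intro mult_right_mono powr_mono) auto
    finally have "?L \<le> X powr (r * \<delta>) * D powr (- (r * l)) * (2 powr (r * l + d) * X powr (r * \<epsilon> - d))"
      unfolding L by (intro mult_left_mono) auto
    also have "\<dots> = 2 powr (r * l + d) * (X powr (r * \<delta>) * X powr (r * \<epsilon> - d)) * D powr (- (r * l))" by simp
    also have "X powr (r * \<delta>) * X powr (r * \<epsilon> - d) = X powr (r * l - d)"
      unfolding l by (simp add: powr_add[symmetric] algebra_simps)
    also have "2 powr (r * l + d) * X powr (r * l - d) * D powr (- (r * l)) = ?F3" using 3 X by simp
    finally show ?thesis using Fnn by linarith
  qed
qed

text \<open>The three summands of the pointwise majorant integrate to multiples of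
  \<open>1 / \<epsilon>\<close>, of \<open>1 / \<delta>\<close> and of 1, the diagonal one because
  \<open>r * l < d\<close>. All powers of \<open>norm x\<close> cancel by homogeneity, so the bound
  is uniform in \<open>x\<close>. The constant depends on \<open>r\<close>, \<open>l\<close> and the
  dimension only and is chosen before \<epsilon> and \<delta>.\<close>

lemma homogeneous_kernel_integral:
  fixes r l :: real
  assumes r: "r > 0" "l > 0" "r * l < DIM('a::euclidean_space)"
  shows "\<exists>C>0. \<forall>\<epsilon> \<delta>. \<epsilon> > 0 \<longrightarrow> \<delta> > 0 \<longrightarrow> \<epsilon> + \<delta> = l \<longrightarrow> (\<forall>x::'a. x \<noteq> 0 \<longrightarrow>
    (\<integral>\<^sup>+y. ennreal ((norm x powr \<delta> * norm (x - y) powr (- l) * norm y powr \<epsilon>) powr r * norm y powr (- real DIM('a))) \<partial>lborel)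
      \<le> ennreal (C / (\<epsilon> * \<delta>)))"
proof -
  let ?d = "real DIM('a)"
  define S where "S = sphere_area TYPE('a)"
  have S: "S > 0" unfolding S_def by (rule sphere_area_pos)
  \<comment> \<open>\<open>E\<close> is the contribution of the diagonal region. In
    \<open>C\<close>, the factor \<open>l\<close> comes from
    \<open>1 / \<epsilon> + 1 / \<delta> = l / (\<epsilon> * \<delta>)\<close>, and
    \<open>l\<^sup>2\<close> from \<open>\<epsilon> * \<delta> \<le> l\<^sup>2\<close>, which
    absorbs the bounded term \<open>E\<close>.\<close>
  define E where "E = 2 powr (r * l + ?d) * (S / (?d - r * l) * 3 powr (?d - r * l))"
  have E: "E > 0" using S r by (simp add: E_def)
  define C where "C = 2 powr (r * l) * S / r * l + E * l\<^sup>2"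
  have C: "C > 0" unfolding C_def using S r E by (intro add_pos_pos mult_pos_pos divide_pos_pos) auto
  have "(\<integral>\<^sup>+y. ennreal ((norm x powr \<delta> * norm (x - y) powr (- l) * norm y powr \<epsilon>) powr r * norm y powr (- ?d)) \<partial>lborel)
      \<le> ennreal (C / (\<epsilon> * \<delta>))" if ed: "\<epsilon> > 0" "\<delta> > 0" "\<epsilon> + \<delta> = l" and x: "x \<noteq> 0" for \<epsilon> \<delta> and x :: 'a
  proof -
    define X where "X = norm x"
    have X: "X > 0" using x by (simp add: X_def)
    have l: "l = \<epsilon> + \<delta>" using ed by simp
    have rep: "r * \<epsilon> > 0" "r * \<delta> > 0" using r ed by auto
    let ?c1 = "2 powr (r * l) * X powr (- (r * \<epsilon>))"
    let ?c2 = "2 powr (r * l) * X powr (r * \<delta>)"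
    let ?c3 = "2 powr (r * l + ?d) * X powr (r * l - ?d)"
    let ?f1 = "\<lambda>y::'a. ennreal (norm y powr (r * \<epsilon> - ?d)) * indicator {y. norm y \<le> X} y"
    let ?f2 = "\<lambda>y::'a. ennreal (norm y powr (- (r * \<delta>) - ?d)) * indicator {y. X \<le> norm y} y"
    let ?h = "\<lambda>y::'a. ennreal (norm y powr (?d - r * l - ?d)) * indicator {y. norm y \<le> 3 * X} y"
    let ?f3 = "\<lambda>y. ?h (x - y)"
    have "(\<integral>\<^sup>+y. ennreal ((norm x powr \<delta> * norm (x - y) powr (- l) * norm y powr \<epsilon>) powr r * norm y powr (- ?d)) \<partial>lborel)
       \<le> (\<integral>\<^sup>+y. ennreal ?c1 * ?f1 y + ennreal ?c2 * ?f2 y + ennreal ?c3 * ?f3 y \<partial>lborel)"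
    proof (rule nn_integral_mono)
      fix y :: 'a
      have tri: "X \<le> norm (x - y) + norm y" "norm y \<le> norm (x - y) + X" "norm (x - y) \<le> X + norm y"
        unfolding X_def using norm_triangle_sub[of x y] norm_triangle_sub[of y x] norm_triangle_ineq4[of x y]
        by (auto simp: norm_minus_commute add.commute)
      have "ennreal ((norm x powr \<delta> * norm (x - y) powr (- l) * norm y powr \<epsilon>) powr r * norm y powr (- ?d))
         \<le> ennreal (?c1 * (norm y powr (r * \<epsilon> - ?d) * indicator {..X} (norm y))
              + ?c2 * (norm y powr (- (r * \<delta>) - ?d) * indicator {X..} (norm y))
              + ?c3 * (norm (x - y) powr (- (r * l)) * indicator {..3 * X} (norm (x - y))))"
        unfolding X_def[symmetric]
        by (intro ennreal_leI homogeneous_kernel_pointwise X tri r ed) auto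
      also have "\<dots> = ennreal ?c1 * ?f1 y + ennreal ?c2 * ?f2 y + ennreal ?c3 * ?f3 y"
        by (simp add: ennreal_mult' ennreal_indicator indicator_def)
      finally show "ennreal ((norm x powr \<delta> * norm (x - y) powr (- l) * norm y powr \<epsilon>) powr r * norm y powr (- ?d))
         \<le> ennreal ?c1 * ?f1 y + ennreal ?c2 * ?f2 y + ennreal ?c3 * ?f3 y" .
    qed
    also have "\<dots> = ennreal ?c1 * (\<integral>\<^sup>+y. ?f1 y \<partial>lborel) + ennreal ?c2 * (\<integral>\<^sup>+y. ?f2 y \<partial>lborel) + ennreal ?c3 * (\<integral>\<^sup>+y. ?f3 y \<partial>lborel)"
      by (simp add: nn_integral_add nn_integral_cmult)
    also have "(\<integral>\<^sup>+y. ?f1 y \<partial>lborel) = ennreal (S / (r * \<epsilon>) * X powr (r * \<epsilon>))"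
      unfolding S_def using rep X by (intro nn_integral_powr_norm_ball) auto
    also have "(\<integral>\<^sup>+y. ?f2 y \<partial>lborel) = ennreal (S / (r * \<delta>) * X powr (- (r * \<delta>)))"
      unfolding S_def using rep X by (intro nn_integral_powr_norm_tail) auto
    also have "(\<integral>\<^sup>+y. ?f3 y \<partial>lborel) = (\<integral>\<^sup>+y. ?h y \<partial>lborel)"
      by (rule nn_integral_diff_lborel) simp
    also have "\<dots> = ennreal (S / (?d - r * l) * (3 * X) powr (?d - r * l))"
      unfolding S_def using r X by (intro nn_integral_powr_norm_ball) auto
    also have "ennreal ?c1 * ennreal (S / (r * \<epsilon>) * X powr (r * \<epsilon>)) + ennreal ?c2 * ennreal (S / (r * \<delta>) * X powr (- (r * \<delta>)))
        + ennreal ?c3 * ennreal (S / (?d - r * l) * (3 * X) powr (?d - r * l))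
      = ennreal (?c1 * (S / (r * \<epsilon>) * X powr (r * \<epsilon>)) + ?c2 * (S / (r * \<delta>) * X powr (- (r * \<delta>)))
        + ?c3 * (S / (?d - r * l) * (3 * X) powr (?d - r * l)))"
    proof -
      have comb: "ennreal a1 * ennreal b1 + ennreal a2 * ennreal b2 + ennreal a3 * ennreal b3 = ennreal (a1 * b1 + a2 * b2 + a3 * b3)"
        if "a1 \<ge> 0" "a2 \<ge> 0" "a3 \<ge> 0" "b1 \<ge> 0" "b2 \<ge> 0" "b3 \<ge> 0" for a1 a2 a3 b1 b2 b3 :: real
        using that by (simp only: ennreal_mult'[symmetric] ennreal_plus[symmetric] mult_nonneg_nonneg add_nonneg_nonneg)
      show ?thesis using S r rep by (intro comb) auto
    qed
    also have "?c1 * (S / (r * \<epsilon>) * X powr (r * \<epsilon>)) = 2 powr (r * l) * S / r * (1 / \<epsilon>)"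
      using X by (simp add: powr_minus)
    also have "?c2 * (S / (r * \<delta>) * X powr (- (r * \<delta>))) = 2 powr (r * l) * S / r * (1 / \<delta>)"
      using X by (simp add: powr_minus)
    also have "?c3 * (S / (?d - r * l) * (3 * X) powr (?d - r * l)) = E * (X powr (r * l - ?d) * X powr (?d - r * l))"
      using X by (simp add: E_def powr_mult)
    also have "X powr (r * l - ?d) * X powr (?d - r * l) = 1"
      using X by (simp add: powr_add[symmetric])
    also have "2 powr (r * l) * S / r * (1 / \<epsilon>) + 2 powr (r * l) * S / r * (1 / \<delta>) + E * 1
      = (2 powr (r * l) * S / r * l + E * (\<epsilon> * \<delta>)) / (\<epsilon> * \<delta>)"
    proof -
      have "c * (1 / \<epsilon>) + c * (1 / \<delta>) + E * 1 = (c * (\<epsilon> + \<delta>) + E * (\<epsilon> * \<delta>)) / (\<epsilon> * \<delta>)" for c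
        using ed(1,2) by (simp add: field_simps)
      then show ?thesis unfolding ed(3) .
    qed
    also have "\<dots> \<le> C / (\<epsilon> * \<delta>)"
    proof -
      have "\<epsilon> * \<delta> \<le> l * l" using ed by (intro mult_mono) auto
      then show ?thesis unfolding C_def power2_eq_square using E ed
        by (intro divide_right_mono add_left_mono mult_left_mono) auto
    qed
    finally show ?thesis by (simp add: ennreal_leI)
  qed
  note main = this
  show ?thesis by (intro exI[of _ C] conjI C allI impI main)
qed

section \<open>The potential of a nonnegative function as an extended real\<close>

text \<open>For nonnegative \<open>g\<close> this is the operator with divergence recorded as
  infinity, free of the default value of the Bochner integral. The weight stands inside the
  integral, so the value at \<open>x = 0\<close> is 0.\<close>

definition riesz_pos :: "real \<Rightarrow> real \<Rightarrow> real \<Rightarrow> ('a::euclidean_space \<Rightarrow> real) \<Rightarrow> 'a \<Rightarrow> ennreal" where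
  "riesz_pos \<alpha> \<beta> l g x = (\<integral>\<^sup>+y. ennreal (norm x powr (- \<beta>) * riesz_integrand \<alpha> l g x y) \<partial>lborel)"

lemma riesz_integrand_measurable:
  "g \<in> borel_measurable borel \<Longrightarrow> riesz_integrand \<alpha> l g x \<in> borel_measurable borel"
proof -
  assume [measurable]: "g \<in> borel_measurable borel"
  have "riesz_integrand \<alpha> l g x = (\<lambda>y. g y * norm y powr (- \<alpha>) / norm (x - y) powr l)"
    by (simp add: riesz_integrand_def fun_eq_iff)
  then show ?thesis by simp
qed

lemma riesz_pos_measurable:
  assumes [measurable]: "g \<in> borel_measurable borel"
  shows "riesz_pos \<alpha> \<beta> l g \<in> borel_measurable borel"
proof -
  have [measurable]: "(\<lambda>(x, y). ennreal (norm x powr (- \<beta>) * (g y * norm y powr (- \<alpha>) / norm (x - y) powr l)))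
     \<in> borel_measurable (borel \<Otimes>\<^sub>M lborel)" by measurable
  have "(\<lambda>x. \<integral>\<^sup>+y. ennreal (norm x powr (- \<beta>) * (g y * norm y powr (- \<alpha>) / norm (x - y) powr l)) \<partial>lborel) \<in> borel_measurable borel"
    by (rule lborel.borel_measurable_nn_integral) simp
  moreover have "riesz_pos \<alpha> \<beta> l g = (\<lambda>x. \<integral>\<^sup>+y. ennreal (norm x powr (- \<beta>) * (g y * norm y powr (- \<alpha>) / norm (x - y) powr l)) \<partial>lborel)"
    by (simp add: riesz_pos_def riesz_integrand_def fun_eq_iff)
  ultimately show ?thesis by simp
qed

text \<open>With \<open>h y = norm y powr (d / p) * g y\<close> and the measure \<open>M\<close>,
  the function \<open>norm x powr (d / q) * riesz_pos \<alpha> \<beta> l g x\<close> is the image of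
  \<open>h\<close> under the kernel of degree 0, and the norms of \<open>g\<close> and of the
  potential become norms with respect to \<open>M\<close>. Young's inequality with
  \<open>r = 1 / \<kappa>\<close> then applies. Positivity of \<open>\<alpha> + \<beta>\<close>
  enters as \<open>l < \<kappa> * d\<close>, that is \<open>r * l < d\<close>.\<close>

lemma riesz_pos_upper_weighted:
  fixes \<alpha> \<beta> l :: real
  assumes ab: "\<alpha> \<ge> 0" "\<beta> \<ge> 0" "l > 0" "\<alpha> + \<beta> + l < DIM('a::euclidean_space)" "\<alpha> + \<beta> > 0"
  defines "\<kappa> \<equiv> (\<alpha> + \<beta> + l) / DIM('a)"
  shows "\<exists>C>0. \<forall>p q \<epsilon> \<delta> (g :: 'a \<Rightarrow> real). p > 1 \<longrightarrow> q > p \<longrightarrow> 1 + 1 / q = 1 / p + \<kappa> \<longrightarrow>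
     \<epsilon> = DIM('a) - \<alpha> - DIM('a) / p \<longrightarrow> \<epsilon> > 0 \<longrightarrow> \<delta> = l - \<epsilon> \<longrightarrow> \<delta> > 0 \<longrightarrow>
     g \<in> borel_measurable borel \<longrightarrow> (\<forall>y. g y \<ge> 0) \<longrightarrow> (\<integral>\<^sup>+y. ennreal (g y powr p) \<partial>lborel) \<le> 1 \<longrightarrow>
     (AE x in lborel. riesz_pos \<alpha> \<beta> l g x < \<infinity>) \<and>
     (\<integral>\<^sup>+x. ennreal (enn2real (riesz_pos \<alpha> \<beta> l g x) powr q) \<partial>lborel) \<le> ennreal ((C / (\<epsilon> * \<delta>) powr \<kappa>) powr q)"
proof -
  let ?d = "real DIM('a)"
  have d: "?d > 0" by simp
  have \<kappa>: "\<kappa> > 0" "\<kappa> < 1" using ab by (auto simp: \<kappa>_def)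
  define r where "r = 1 / \<kappa>"
  have r: "r > 1" "1 / r = \<kappa>" using \<kappa> by (auto simp: r_def)
  have "l < \<kappa> * ?d" using ab by (simp add: \<kappa>_def)
  then have rl: "r * l < ?d" using \<kappa> by (simp add: r_def field_simps)
  obtain C where C: "C > 0" and Cb: "\<And>\<epsilon> \<delta> (x::'a). \<epsilon> > 0 \<Longrightarrow> \<delta> > 0 \<Longrightarrow> \<epsilon> + \<delta> = l \<Longrightarrow> x \<noteq> 0 \<Longrightarrow>
    (\<integral>\<^sup>+y. ennreal ((norm x powr \<delta> * norm (x - y) powr (- l) * norm y powr \<epsilon>) powr r * norm y powr (- ?d)) \<partial>lborel)
      \<le> ennreal (C / (\<epsilon> * \<delta>))"
    using homogeneous_kernel_integral[where 'a='a, of r l] r ab rl by auto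
  \<comment> \<open>The dilation-invariant measure. Its density is 0 at the origin by the convention
    for \<open>powr\<close>, hence finite everywhere, which gives sigma-finiteness.\<close>
  define M where "M = density lborel (\<lambda>y::'a. ennreal (norm y powr (- ?d)))"
  have [measurable_cong]: "sets M = sets borel" by (simp add: M_def)
  have sf: "sigma_finite_measure M"
    unfolding M_def by (subst sigma_finite_measure.sigma_finite_iff_density_finite[OF lborel.sigma_finite_measure_axioms]) auto
  have nz: "AE x in lborel. x \<noteq> (0::'a)" by (rule AE_lborel_singleton)
  have "(AE x in lborel. riesz_pos \<alpha> \<beta> l g x < \<infinity>) \<and>
     (\<integral>\<^sup>+x. ennreal (enn2real (riesz_pos \<alpha> \<beta> l g x) powr q) \<partial>lborel) \<le> ennreal ((C powr \<kappa> / (\<epsilon> * \<delta>) powr \<kappa>) powr q)"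
    if p: "p > 1" "q > p" "1 + 1 / q = 1 / p + \<kappa>"
      and e: "\<epsilon> = ?d - \<alpha> - ?d / p" "\<epsilon> > 0" "\<delta> = l - \<epsilon>" "\<delta> > 0"
      and [measurable]: "g \<in> borel_measurable borel" and g: "\<And>y. g y \<ge> 0" "(\<integral>\<^sup>+y. ennreal (g y powr p) \<partial>lborel) \<le> 1"
    for p q \<epsilon> \<delta> and g :: "'a \<Rightarrow> real"
  proof -
    \<comment> \<open>Multiplying the relation between \<open>p\<close> and \<open>q\<close> by
      \<open>d\<close> shows that \<open>norm x\<close> receives the exponent \<delta>, the
      counterpart of \<epsilon> at \<open>norm y\<close>.\<close>
    have "?d * (1 + 1 / q) = ?d * (1 / p + \<kappa>)" using p(3) by simp
    then have "?d + ?d / q = ?d / p + ?d * \<kappa>" by (simp add: distrib_left)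
    moreover have "?d * \<kappa> = \<alpha> + \<beta> + l" by (simp add: \<kappa>_def)
    ultimately have dq: "?d / q - \<beta> = \<delta>" using e by linarith
    define A where "A = C / (\<epsilon> * \<delta>)"
    have A: "A \<ge> 0" using C e by (simp add: A_def)
    define K where "K x y = norm x powr \<delta> * norm (x - y) powr (- l) * norm y powr \<epsilon>" for x y :: 'a
    define h where "h y = norm y powr (?d / p) * g y" for y
    have [measurable]: "h \<in> borel_measurable borel" unfolding h_def by measurable
    have Kmeas: "case_prod K \<in> borel_measurable (M \<Otimes>\<^sub>M M)"
      unfolding K_def by measurable
    have row: "AE x in M. (\<integral>\<^sup>+y. ennreal (K x y powr r) \<partial>M) \<le> ennreal A"
    proof -
      have "(\<integral>\<^sup>+y. ennreal (K x y powr r) \<partial>M) \<le> ennreal A" if "x \<noteq> 0" for x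
        using Cb[of \<epsilon> \<delta> x] that e unfolding M_def K_def A_def
        by (subst nn_integral_density) (auto simp: ennreal_mult'[symmetric] mult.commute)
      then show ?thesis using nz unfolding M_def by (subst AE_density) auto
    qed
    \<comment> \<open>Exchanging \<open>x\<close> with \<open>y\<close> and \<epsilon> with \<delta>
      leaves the kernel unchanged, so the row bound with swapped parameters is the column
      bound.\<close>
    have col: "AE y in M. (\<integral>\<^sup>+x. ennreal (K x y powr r) \<partial>M) \<le> ennreal A"
    proof -
      have "(\<integral>\<^sup>+x. ennreal (K x y powr r) \<partial>M) \<le> ennreal A" if "y \<noteq> 0" for y
        using Cb[of \<delta> \<epsilon> y] that e unfolding M_def K_def A_def
        by (subst nn_integral_density) (auto simp: ennreal_mult'[symmetric] mult.commute mult.left_commute norm_minus_commute)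
      then show ?thesis using nz unfolding M_def by (subst AE_density) auto
    qed
    have "(\<integral>\<^sup>+y. ennreal (h y powr p) \<partial>M) = (\<integral>\<^sup>+y. ennreal (norm y powr (- ?d) * h y powr p) \<partial>lborel)"
      unfolding M_def by (subst nn_integral_density) (auto simp: ennreal_mult')
    \<comment> \<open>The integrands agree for \<open>y \<noteq> 0\<close>; at the origin the left
      one is 0, so the pointwise relation is only an inequality.\<close>
    also have "\<dots> \<le> (\<integral>\<^sup>+y. ennreal (g y powr p) \<partial>lborel)"
    proof (rule nn_integral_mono)
      fix y :: 'a
      have "norm y powr (- ?d) * h y powr p \<le> g y powr p"
        using g p by (cases "y = 0") (auto simp: h_def powr_mult powr_powr powr_minus field_simps)
      then show "ennreal (norm y powr (- ?d) * h y powr p) \<le> ennreal (g y powr p)" by (rule ennreal_leI)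
    qed
    also note g(2)
    finally have h1: "(\<integral>\<^sup>+y. ennreal (h y powr p) \<partial>M) \<le> 1" .
    have Kn: "K x y \<ge> 0" for x y by (simp add: K_def)
    have hn: "h y \<ge> 0" for y using g(1) by (simp add: h_def)
    have hM: "h \<in> borel_measurable M" by measurable
    have pq: "1 + 1 / q = 1 / p + 1 / r" and q1: "q > 1" using p r by auto
    define T where "T x = (\<integral>\<^sup>+y. ennreal (K x y * h y) \<partial>M)" for x
    have Y: "AE x in M. T x < \<infinity>"
       "(\<integral>\<^sup>+x. ennreal (enn2real (T x) powr q) \<partial>M) \<le> ennreal ((A powr (1 / r)) powr q)"
      unfolding T_def
      using Young_kernel[OF sf sf Kmeas hM Kn hn pq p(1) q1 r(1) A row col h1] by blast+
    have T: "T x = ennreal (norm x powr (?d / q)) * riesz_pos \<alpha> \<beta> l g x" for x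
    proof -
      have 1: "norm y powr (- ?d) * (K x y * h y) = norm x powr (?d / q) * (norm x powr (- \<beta>) * riesz_integrand \<alpha> l g x y)" for y
      proof -
        have "norm x powr \<delta> = norm x powr (?d / q) * norm x powr (- \<beta>)"
          using dq by (simp add: powr_add[symmetric])
        moreover have "norm y powr (- ?d) * norm y powr \<epsilon> * norm y powr (?d / p) = norm y powr (- \<alpha>)"
          using e(1) by (simp add: powr_add[symmetric])
        moreover have "norm y powr (- ?d) * (K x y * h y) = norm x powr \<delta> * norm (x - y) powr (- l) *
            (norm y powr (- ?d) * norm y powr \<epsilon> * norm y powr (?d / p)) * g y"
          by (simp only: K_def h_def mult_ac)
        ultimately have "norm y powr (- ?d) * (K x y * h y) =
            norm x powr (?d / q) * norm x powr (- \<beta>) * norm (x - y) powr (- l) * norm y powr (- \<alpha>) * g y"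
          by simp
        then show ?thesis
          by (simp only: riesz_integrand_def powr_minus_divide[of "norm (x - y)"]) simp
      qed
      have "T x = (\<integral>\<^sup>+y. ennreal (norm y powr (- ?d) * (K x y * h y)) \<partial>lborel)"
        unfolding T_def M_def
        by (subst nn_integral_density) (auto simp: ennreal_mult' K_def)
      also have "\<dots> = ennreal (norm x powr (?d / q)) * riesz_pos \<alpha> \<beta> l g x"
      proof -
        have [measurable]: "riesz_integrand \<alpha> l g x \<in> borel_measurable borel"
          by (rule riesz_integrand_measurable) simp
        have "(\<integral>\<^sup>+y. ennreal (norm y powr (- ?d) * (K x y * h y)) \<partial>lborel)
          = (\<integral>\<^sup>+y. ennreal (norm x powr (?d / q)) * ennreal (norm x powr (- \<beta>) * riesz_integrand \<alpha> l g x y) \<partial>lborel)"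
        proof (rule nn_integral_cong)
          fix y
          show "ennreal (norm y powr (- ?d) * (K x y * h y))
             = ennreal (norm x powr (?d / q)) * ennreal (norm x powr (- \<beta>) * riesz_integrand \<alpha> l g x y)"
            unfolding 1 by (rule ennreal_mult') simp
        qed
        also have "\<dots> = ennreal (norm x powr (?d / q)) * riesz_pos \<alpha> \<beta> l g x"
          unfolding riesz_pos_def by (rule nn_integral_cmult) simp
        finally show ?thesis .
      qed
      finally show ?thesis .
    qed
    have [measurable]: "riesz_pos \<alpha> \<beta> l g \<in> borel_measurable borel"
      by (rule riesz_pos_measurable) simp
    have "AE x in lborel. T x < \<infinity>"
      using Y(1) nz unfolding M_def T by (subst (asm) AE_density) auto
    then have "AE x in lborel. riesz_pos \<alpha> \<beta> l g x < \<infinity>"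
      using nz unfolding T
    proof eventually_elim
      case (elim x)
      then show ?case by (auto simp: ennreal_mult_less_top)
    qed
    moreover have "(\<integral>\<^sup>+x. ennreal (enn2real (riesz_pos \<alpha> \<beta> l g x) powr q) \<partial>lborel) = (\<integral>\<^sup>+x. ennreal (enn2real (T x) powr q) \<partial>M)"
    proof -
      have "(\<integral>\<^sup>+x. ennreal (enn2real (T x) powr q) \<partial>M) = (\<integral>\<^sup>+x. ennreal (norm x powr (- ?d)) * ennreal (enn2real (T x) powr q) \<partial>lborel)"
        unfolding M_def T by (subst nn_integral_density) auto
      also have "\<dots> = (\<integral>\<^sup>+x. ennreal (enn2real (riesz_pos \<alpha> \<beta> l g x) powr q) \<partial>lborel)"
      proof (rule nn_integral_cong_AE)
        show "AE x in lborel. ennreal (norm x powr (- ?d)) * ennreal (enn2real (T x) powr q) = ennreal (enn2real (riesz_pos \<alpha> \<beta> l g x) powr q)"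
          using nz
        proof eventually_elim
          case (elim x)
          have "norm x powr (- ?d) * (enn2real (T x) powr q) = enn2real (riesz_pos \<alpha> \<beta> l g x) powr q"
            unfolding T using elim p by (simp add: enn2real_mult powr_mult powr_powr powr_minus)
          then show ?case by (metis ennreal_mult' powr_ge_zero)
        qed
      qed
      finally show ?thesis ..
    qed
    moreover have "A powr (1 / r) = C powr \<kappa> / (\<epsilon> * \<delta>) powr \<kappa>"
      using C e unfolding A_def r(2) by (simp add: powr_divide)
    ultimately show ?thesis using Y(2) by simp
  qed
  note main = this
  have "C powr \<kappa> > 0" using C by simp
  with main show ?thesis by (intro exI[of _ "C powr \<kappa>"] conjI allI impI) blast+
qed

section \<open>Unweighted upper bound\<close>

lemma ennreal_add_le_cancel_half:
  assumes "ennreal (2 * c) \<le> h" "h \<le> ennreal c + z" "c \<ge> 0"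
  shows "ennreal c \<le> z"
proof -
  have "ennreal c + ennreal c \<le> ennreal c + z"
    using order.trans[OF assms(1,2)] assms(3) by (simp add: ennreal_plus[symmetric] del: ennreal_plus)
  then show ?thesis by simp
qed

section \<open>Splitting the unweighted potential into near and far parts\<close>

text \<open>Hoelder's inequality with conjugate exponent \<open>1 / t\<close>, where
  \<open>t = 1 - 1 / p\<close>. The power \<open>l / t = \<delta> / t + d\<close> of the kernel is
  integrable at infinity precisely because \<open>\<delta> > 0\<close>, and its tail integral
  carries the factor \<open>t / \<delta>\<close>. This is the source of the growth of the constant
  at the upper end of the range of \<open>p\<close>.\<close>

lemma Riesz_tail_Holder:
  fixes x :: "'a::euclidean_space" and g :: "'a \<Rightarrow> real" and p l \<delta> R :: real
  assumes [measurable]: "g \<in> borel_measurable borel" and g: "\<And>y. g y \<ge> 0" "(\<integral>\<^sup>+y. ennreal (g y powr p) \<partial>lborel) \<le> 1"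
    and p: "p > 1" and \<delta>: "\<delta> = l - DIM('a) + DIM('a) / p" "\<delta> > 0" and R: "R > 0"
  shows "(\<integral>\<^sup>+y. ennreal (g y * norm (x - y) powr (- l)) * indicator {y. R \<le> norm (x - y)} y \<partial>lborel)
    \<le> ennreal ((sphere_area TYPE('a) * (1 - 1 / p) / \<delta>) powr (1 - 1 / p) * R powr (- \<delta>))"
proof -
  let ?d = "real DIM('a)"
  define t where "t = 1 - 1 / p"
  have t: "0 < t" "t < 1" "1 - t = 1 / p" using p by (auto simp: t_def)
  define b where "b y = norm (x - y) powr (- (l / t)) * indicator {y. R \<le> norm (x - y)} y" for y
  have [measurable]: "b \<in> borel_measurable borel" unfolding b_def by measurable
  have bn: "b y \<ge> 0" for y by (simp add: b_def)
  have lt: "l / t = \<delta> / t + ?d"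
  proof -
    have "l = \<delta> + ?d * t" using \<delta>(1) by (simp add: t_def algebra_simps)
    then show ?thesis using t by (simp add: add_divide_distrib)
  qed
  let ?h = "\<lambda>z::'a. ennreal (norm z powr (- (\<delta> / t) - ?d)) * indicator {z. R \<le> norm z} z"
  have "(\<integral>\<^sup>+y. ennreal (b y) \<partial>lborel) = (\<integral>\<^sup>+y. ?h (x - y) \<partial>lborel)"
    unfolding b_def lt by (intro nn_integral_cong) (auto split: split_indicator)
  also have "\<dots> = (\<integral>\<^sup>+y. ?h y \<partial>lborel)" by (rule nn_integral_diff_lborel) simp
  also have "\<dots> = ennreal (sphere_area TYPE('a) / (\<delta> / t) * R powr (- (\<delta> / t)))"
    using \<delta> t R by (intro nn_integral_powr_norm_tail) auto
  finally have b: "(\<integral>\<^sup>+y. ennreal (b y) \<partial>lborel) = ennreal (sphere_area TYPE('a) / (\<delta> / t) * R powr (- (\<delta> / t)))" .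
  have S: "sphere_area TYPE('a) > 0" by (rule sphere_area_pos)
  have "(\<integral>\<^sup>+y. ennreal (b y powr t * (g y powr p) powr (1 - t)) \<partial>lborel)
      \<le> ennreal ((sphere_area TYPE('a) / (\<delta> / t) * R powr (- (\<delta> / t))) powr t * 1 powr (1 - t))"
    using b g t \<delta> S bn by (intro nn_integral_Holder) auto
  also have "(sphere_area TYPE('a) / (\<delta> / t) * R powr (- (\<delta> / t))) powr t * 1 powr (1 - t)
      = (sphere_area TYPE('a) * (1 - 1 / p) / \<delta>) powr (1 - 1 / p) * R powr (- \<delta>)"
  proof -
    have "(R powr (- (\<delta> / t))) powr t = R powr (- \<delta>)" using t by (simp add: powr_powr)
    then show ?thesis by (simp only: powr_mult t_def[symmetric]) simp
  qed
  also have "(\<integral>\<^sup>+y. ennreal (b y powr t * (g y powr p) powr (1 - t)) \<partial>lborel)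
      = (\<integral>\<^sup>+y. ennreal (g y * norm (x - y) powr (- l)) * indicator {y. R \<le> norm (x - y)} y \<partial>lborel)"
  proof (rule nn_integral_cong)
    fix y
    have "(g y powr p) powr (1 - t) = g y" using g p t by (simp add: powr_powr)
    then show "ennreal (b y powr t * (g y powr p) powr (1 - t)) = ennreal (g y * norm (x - y) powr (- l)) * indicator {y. R \<le> norm (x - y)} y"
      using t by (auto simp: b_def powr_powr mult.commute split: split_indicator)
  qed
  finally show ?thesis .
qed

text \<open>
  Splitting at radius \<open>t powr (- p / d)\<close> makes the far part and the near part of the truncation
  \<open>g < t\<close> both of size \<open>t powr (p / q)\<close>, so that only the large values of \<open>g\<close> contribute to the
  level set. This is the same inequality as Doob's for the power \<open>q / p\<close> of the potential.
\<close>

lemma Riesz_level_set: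
  fixes g :: "'a::euclidean_space \<Rightarrow> real" and p q l \<delta> :: real
  assumes [measurable]: "g \<in> borel_measurable borel" and g: "\<And>y. g y \<ge> 0" "(\<integral>\<^sup>+y. ennreal (g y powr p) \<partial>lborel) \<le> 1"
    and p: "p > 1" "q > 0" "1 + 1 / q = 1 / p + l / DIM('a)" and l: "l < DIM('a)"
    and \<delta>: "\<delta> = l - DIM('a) + DIM('a) / p" "\<delta> > 0"
  defines "H \<equiv> \<lambda>x. \<integral>\<^sup>+y. ennreal (g y * norm (x - y) powr (- l)) \<partial>lborel"
    and "A \<equiv> sphere_area TYPE('a) / (DIM('a) - l)"
    and "B \<equiv> (sphere_area TYPE('a) * (1 - 1 / p) / \<delta>) powr (1 - 1 / p)"
  assumes t: "t > 0"
  shows "emeasure lborel {x. ennreal (2 * (A + B) * t powr (p / q)) \<le> H x}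
    \<le> ennreal (1 / t) * (\<integral>\<^sup>+y. ennreal (g y) * indicator {y. t \<le> g y} y \<partial>lborel)"
proof -
  let ?d = "real DIM('a)"
  have S: "sphere_area TYPE('a) > 0" by (rule sphere_area_pos)
  have A: "A > 0" using S l by (simp add: A_def)
  have B: "B \<ge> 0" by (simp add: B_def)
  define R where "R = t powr (- p / ?d)"
  have R: "R > 0" using t by (simp add: R_def)
  define c where "c = p / q"
  have pd: "p * (l / ?d) = p * (1 + 1 / q) - 1" using p by (simp add: distrib_left)
  have R1: "R powr (?d - l) = t powr (c - 1)"
  proof -
    have "- p / ?d * (?d - l) = p * (l / ?d) - p" by (simp add: field_simps)
    also have "\<dots> = c - 1" unfolding pd by (simp add: c_def distrib_left)
    finally show ?thesis by (simp only: R_def powr_powr)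
  qed
  have R2: "R powr (- \<delta>) = t powr c"
  proof -
    have "- p / ?d * (- \<delta>) = p * (l / ?d) - p + 1" using p by (simp add: \<delta>(1) field_simps)
    also have "\<dots> = c" unfolding pd by (simp add: c_def distrib_left)
    finally show ?thesis by (simp only: R_def powr_powr)
  qed
  define k where "k z = ennreal (norm z powr (?d - l - ?d)) * indicator {z. norm z \<le> R} z" for z :: 'a
  have [measurable]: "k \<in> borel_measurable borel" unfolding k_def by measurable
  have k: "(\<integral>\<^sup>+z. k z \<partial>lborel) = ennreal (A * t powr (c - 1))"
    unfolding k_def using nn_integral_powr_norm_ball[where 'a='a, of "?d - l" R] l R by (simp add: A_def R1)
  define Z where "Z x = (\<integral>\<^sup>+y. (ennreal (g y) * indicator {y. t \<le> g y} y) * k (x - y) \<partial>lborel)" for x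
  have [measurable]: "Z \<in> borel_measurable borel" unfolding Z_def by measurable
  have tail: "(\<integral>\<^sup>+y. ennreal (g y * norm (x - y) powr (- l)) * indicator {y. R \<le> norm (x - y)} y \<partial>lborel) \<le> ennreal (B * t powr c)" for x
    using Riesz_tail_Holder[OF _ g p(1) \<delta> R, of x] by (simp add: B_def R2)
  \<comment> \<open>Three regions: the far part is bounded by Hoelder's inequality, the near part
    with \<open>g y \<le> t\<close> by \<open>t\<close> times the mass of \<open>k\<close>, and the
    near part with \<open>g y \<ge> t\<close> is kept as \<open>Z\<close>.\<close>
  have HZ: "H x \<le> ennreal ((A + B) * t powr c) + Z x" for x
  proof -
    have "H x \<le> (\<integral>\<^sup>+y. (ennreal t * k (x - y) + (ennreal (g y) * indicator {y. t \<le> g y} y) * k (x - y))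
        + ennreal (g y * norm (x - y) powr (- l)) * indicator {y. R \<le> norm (x - y)} y \<partial>lborel)"
      unfolding H_def
    proof (rule nn_integral_mono)
      fix y
      consider "R \<le> norm (x - y)" | "norm (x - y) \<le> R" "t \<le> g y" | "norm (x - y) \<le> R" "g y \<le> t" by linarith
      then show "ennreal (g y * norm (x - y) powr (- l)) \<le> (ennreal t * k (x - y) + (ennreal (g y) * indicator {y. t \<le> g y} y) * k (x - y))
        + ennreal (g y * norm (x - y) powr (- l)) * indicator {y. R \<le> norm (x - y)} y"
      proof cases
        case 1
        then show ?thesis by simp
      next
        case 2
        then have "ennreal (g y * norm (x - y) powr (- l)) = (ennreal (g y) * indicator {y. t \<le> g y} y) * k (x - y)"
          using g(1)[of y] by (simp add: k_def ennreal_mult')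
        then show ?thesis by (simp add: add_increasing add_increasing2)
      next
        case 3
        then have "ennreal (g y * norm (x - y) powr (- l)) \<le> ennreal t * k (x - y)"
          using t by (simp add: k_def ennreal_mult'[symmetric] ennreal_leI mult_right_mono)
        then show ?thesis by (meson add_increasing2 order.trans zero_le)
      qed
    qed
    also have "\<dots> = (ennreal t * (\<integral>\<^sup>+y. k (x - y) \<partial>lborel) + Z x)
       + (\<integral>\<^sup>+y. ennreal (g y * norm (x - y) powr (- l)) * indicator {y. R \<le> norm (x - y)} y \<partial>lborel)"
      unfolding Z_def by (simp add: nn_integral_add nn_integral_cmult)
    also have "\<dots> \<le> (ennreal (A * t powr c) + Z x) + ennreal (B * t powr c)"
    proof (intro add_mono tail order.refl)
      have "t powr c = t powr (c - 1) * t powr 1" by (simp only: powr_add[symmetric]) simp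
      then have "t * (A * t powr (c - 1)) = A * t powr c" using t by simp
      moreover have "ennreal t * (\<integral>\<^sup>+y. k (x - y) \<partial>lborel) = ennreal (t * (A * t powr (c - 1)))"
        using t by (simp add: nn_integral_diff_lborel k ennreal_mult')
      ultimately show "ennreal t * (\<integral>\<^sup>+y. k (x - y) \<partial>lborel) \<le> ennreal (A * t powr c)"
        by (metis order.refl)
    qed
    also have "\<dots> = ennreal ((A + B) * t powr c) + Z x"
    proof -
      have "ennreal ((A + B) * t powr c) = ennreal (A * t powr c) + ennreal (B * t powr c)"
        unfolding distrib_right using A B by (intro ennreal_plus) auto
      then show ?thesis by (simp only: add_ac)
    qed
    finally show ?thesis .
  qed
  \<comment> \<open>Where the potential reaches \<open>2 * w\<close>, at least \<open>w\<close> must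
    come from \<open>Z\<close>. Markov's inequality for \<open>Z\<close> then bounds the level set,
    and Tonelli evaluates the integral of \<open>Z\<close>.\<close>
  define w where "w = (A + B) * t powr c"
  have w: "w > 0" using A B t by (simp add: w_def add_pos_nonneg)
  have "{x. ennreal (2 * (A + B) * t powr (p / q)) \<le> H x} \<subseteq> {x \<in> UNIV. 1 \<le> ennreal (1 / w) * Z x}"
  proof (rule subsetI)
    fix x assume "x \<in> {x. ennreal (2 * (A + B) * t powr (p / q)) \<le> H x}"
    then have "ennreal (2 * w) \<le> H x" by (simp only: mem_Collect_eq w_def c_def mult.assoc)
    from ennreal_add_le_cancel_half[OF this HZ[folded w_def]] w have "ennreal w \<le> Z x" by simp
    then have "ennreal (1 / w) * ennreal w \<le> ennreal (1 / w) * Z x" by (rule mult_left_mono) simp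
    then show "x \<in> {x \<in> UNIV. 1 \<le> ennreal (1 / w) * Z x}" using w by (simp add: ennreal_mult'[symmetric])
  qed
  then have "emeasure lborel {x. ennreal (2 * (A + B) * t powr (p / q)) \<le> H x} \<le> emeasure lborel {x \<in> UNIV. 1 \<le> ennreal (1 / w) * Z x}"
    by (rule emeasure_mono) simp
  also have "\<dots> \<le> ennreal (1 / w) * (\<integral>\<^sup>+x. Z x * indicator UNIV x \<partial>lborel)"
    by (rule nn_integral_Markov_inequality) auto
  also have "(\<integral>\<^sup>+x. Z x * indicator UNIV x \<partial>lborel) = (\<integral>\<^sup>+x. Z x \<partial>lborel)" by simp
  also have "\<dots> = (\<integral>\<^sup>+y. (\<integral>\<^sup>+x. (ennreal (g y) * indicator {y. t \<le> g y} y) * k (x - y) \<partial>lborel) \<partial>lborel)"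
    unfolding Z_def by (rule lborel_pair.Fubini') measurable
  also have "\<dots> = (\<integral>\<^sup>+y. (ennreal (g y) * indicator {y. t \<le> g y} y) * ennreal (A * t powr (c - 1)) \<partial>lborel)"
  proof (rule nn_integral_cong)
    fix y
    have "(\<integral>\<^sup>+x. k (x - y) \<partial>lborel) = (\<integral>\<^sup>+x. k (y - x) \<partial>lborel)"
      by (simp only: k_def mem_Collect_eq indicator_def norm_minus_commute[of _ y])
    also have "\<dots> = ennreal (A * t powr (c - 1))" by (simp add: nn_integral_diff_lborel k)
    finally show "(\<integral>\<^sup>+x. (ennreal (g y) * indicator {y. t \<le> g y} y) * k (x - y) \<partial>lborel)
       = (ennreal (g y) * indicator {y. t \<le> g y} y) * ennreal (A * t powr (c - 1))"
      by (simp add: nn_integral_cmult)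
  qed
  also have "\<dots> = (\<integral>\<^sup>+y. ennreal (g y) * indicator {y. t \<le> g y} y \<partial>lborel) * ennreal (A * t powr (c - 1))"
    by (rule nn_integral_multc) simp
  also have "ennreal (1 / w) * \<dots> = ennreal (1 / w * (A * t powr (c - 1))) * (\<integral>\<^sup>+y. ennreal (g y) * indicator {y. t \<le> g y} y \<partial>lborel)"
  proof -
    have "ennreal (1 / w * (A * t powr (c - 1))) = ennreal (1 / w) * ennreal (A * t powr (c - 1))"
      using w by (intro ennreal_mult') simp
    then show ?thesis by (simp only: mult_ac)
  qed
  also have "\<dots> \<le> ennreal (1 / t) * (\<integral>\<^sup>+y. ennreal (g y) * indicator {y. t \<le> g y} y \<partial>lborel)"
  proof (intro mult_right_mono ennreal_leI)
    have "t powr c = t powr (c - 1) * t powr 1" by (simp only: powr_add[symmetric]) simp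
    \<comment> \<open>The level contains the constant \<open>A + B \<ge> A\<close>, so the mass of
      the near kernel divided by \<open>w\<close> does not exceed \<open>1 / t\<close>, without any
      extra factor.\<close>
    then have "1 / w * (A * t powr (c - 1)) = A / (A + B) * (1 / t)"
      using t A B by (simp add: w_def)
    also have "\<dots> \<le> 1 * (1 / t)" using A B t by (intro mult_right_mono) auto
    finally show "1 / w * (A * t powr (c - 1)) \<le> 1 / t" by simp
  qed simp
  finally show ?thesis .
qed

text \<open>The power \<open>u = (H / W) powr (q / p)\<close> carries the level
  \<open>W * t powr (p / q)\<close> of \<open>H\<close> to the level \<open>t\<close>, so the level
  set estimate becomes the hypothesis of the layer cake argument, and \<open>u powr p\<close> is a
  multiple of \<open>H powr q\<close>. The set where \<open>H\<close> is infinite lies in every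
  level set and is therefore null.\<close>

lemma Riesz_strong_bound:
  fixes g :: "'a::euclidean_space \<Rightarrow> real" and p q l \<delta> :: real
  assumes g0[measurable]: "g \<in> borel_measurable borel" and g: "\<And>y. g y \<ge> 0" "(\<integral>\<^sup>+y. ennreal (g y powr p) \<partial>lborel) \<le> 1"
    and p: "p > 1" "q > 0" "1 + 1 / q = 1 / p + l / DIM('a)" and l: "l < DIM('a)"
    and \<delta>: "\<delta> = l - DIM('a) + DIM('a) / p" "\<delta> > 0"
  defines "H \<equiv> \<lambda>x. \<integral>\<^sup>+y. ennreal (g y * norm (x - y) powr (- l)) \<partial>lborel"
    and "A \<equiv> sphere_area TYPE('a) / (DIM('a) - l)"
    and "B \<equiv> (sphere_area TYPE('a) * (1 - 1 / p) / \<delta>) powr (1 - 1 / p)"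
  shows "AE x in lborel. H x < \<infinity>"
    and "(\<integral>\<^sup>+x. ennreal (enn2real (H x) powr q) \<partial>lborel) \<le> ennreal ((2 * (A + B)) powr q * (p / (p - 1)))"
proof -
  have S: "sphere_area TYPE('a) > 0" by (rule sphere_area_pos)
  have A: "A > 0" using S l by (simp add: A_def)
  have B: "B \<ge> 0" by (simp add: B_def)
  define W where "W = 2 * (A + B)"
  have W: "W > 0" using A B by (simp add: W_def)
  have [measurable]: "H \<in> borel_measurable borel" unfolding H_def by measurable
  define J where "J t = (\<integral>\<^sup>+y. ennreal (g y) * indicator {y. t \<le> g y} y \<partial>lborel)" for t
  have lev: "emeasure lborel {x. ennreal (W * t powr (p / q)) \<le> H x} \<le> ennreal (1 / t) * J t" if "t > 0" for t
    unfolding H_def W_def A_def B_def J_def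
    by (rule Riesz_level_set[OF g0 g p l \<delta> that])
  show "AE x in lborel. H x < \<infinity>"
  proof -
    have "emeasure lborel {x. H x = \<infinity>} \<le> ennreal e" if e: "e > 0" for e
    proof -
      \<comment> \<open>\<open>t \<ge> 1\<close> gives \<open>g y \<le> g y powr p\<close> wherever
        \<open>g y \<ge> t\<close>, so the truncated integral is at most 1;
        \<open>1 / t \<le> e\<close> does the rest.\<close>
      define t where "t = max 1 (1 / e)"
      have t: "t \<ge> 1" "1 / t \<le> e" using e by (auto simp: t_def max_def field_simps)
      have "emeasure lborel {x. H x = \<infinity>} \<le> emeasure lborel {x. ennreal (W * t powr (p / q)) \<le> H x}"
        by (rule emeasure_mono) auto
      also have "\<dots> \<le> ennreal (1 / t) * J t" using t by (intro lev) auto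
      also have "J t \<le> (\<integral>\<^sup>+y. ennreal (g y powr p) \<partial>lborel)"
        unfolding J_def
      proof (rule nn_integral_mono)
        fix y show "ennreal (g y) * indicator {y. t \<le> g y} y \<le> ennreal (g y powr p)"
          using t p powr_mono[of 1 p "g y"] by (auto split: split_indicator intro!: ennreal_leI)
      qed
      also note g(2)
      also have "ennreal (1 / t) * 1 \<le> ennreal e" using t by (simp add: ennreal_leI)
      finally show ?thesis by (simp add: mult_left_mono)
    qed
    note small = this
    have "emeasure lborel {x. H x = \<infinity>} \<le> 0"
    proof (rule ennreal_le_epsilon)
      fix e :: real assume "e > 0"
      from small[OF this] show "emeasure lborel {x. H x = \<infinity>} \<le> 0 + ennreal e" by simp
    qed
    then have "{x. H x = \<infinity>} \<in> null_sets lborel" by (auto simp: null_sets_def)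
    then show ?thesis by (rule AE_I') (auto simp: less_top[symmetric])
  qed
  define u where "u x = (enn2real (H x) / W) powr (q / p)" for x
  have [measurable]: "u \<in> borel_measurable borel" unfolding u_def by measurable
  have "(\<integral>\<^sup>+x. ennreal (u x powr p) \<partial>lborel) \<le> ennreal (p / (p - 1)) * (\<integral>\<^sup>+y. ennreal (g y powr p) \<partial>lborel)"
  proof (rule layer_cake_weak_to_strong[OF lborel.sigma_finite_measure_axioms lborel.sigma_finite_measure_axioms])
    fix t :: real assume t: "t > 0"
    have "{x \<in> space lborel. t \<le> u x} \<subseteq> {x. ennreal (W * t powr (p / q)) \<le> H x}"
    proof clarsimp
      fix x assume "t \<le> u x"
      then have "t powr (p / q) \<le> u x powr (p / q)" using t p by (intro powr_mono2) auto
      also have "\<dots> = enn2real (H x) / W" using p W by (simp add: u_def powr_powr)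
      finally have "W * t powr (p / q) \<le> enn2real (H x)" using W by (simp add: field_simps)
      then have "ennreal (W * t powr (p / q)) \<le> ennreal (enn2real (H x))" by (rule ennreal_leI)
      also have "\<dots> \<le> H x" by (cases "H x") auto
      finally show "ennreal (W * t powr (p / q)) \<le> H x" .
    qed
    then have "emeasure lborel {x \<in> space lborel. t \<le> u x} \<le> emeasure lborel {x. ennreal (W * t powr (p / q)) \<le> H x}"
      by (rule emeasure_mono) simp
    also note lev[OF t]
    finally show "emeasure lborel {x \<in> space lborel. t \<le> u x} \<le> ennreal (1 / t) * (\<integral>\<^sup>+y. ennreal (g y) * indicator {y. t \<le> g y} y \<partial>lborel)"
      unfolding J_def .
  qed (use p g in \<open>auto simp: u_def\<close>)
  also have "\<dots> \<le> ennreal (p / (p - 1)) * 1" by (intro mult_left_mono g) simp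
  finally have U: "(\<integral>\<^sup>+x. ennreal (u x powr p) \<partial>lborel) \<le> ennreal (p / (p - 1))" by simp
  have "enn2real (H x) powr q = W powr q * u x powr p" for x
    using p W by (simp add: u_def powr_powr powr_divide)
  then have "(\<integral>\<^sup>+x. ennreal (enn2real (H x) powr q) \<partial>lborel) = (\<integral>\<^sup>+x. ennreal (W powr q) * ennreal (u x powr p) \<partial>lborel)"
    by (simp add: ennreal_mult')
  also have "\<dots> = ennreal (W powr q) * (\<integral>\<^sup>+x. ennreal (u x powr p) \<partial>lborel)" by (rule nn_integral_cmult) simp
  also have "\<dots> \<le> ennreal (W powr q) * ennreal (p / (p - 1))" by (intro mult_left_mono U) simp
  finally show "(\<integral>\<^sup>+x. ennreal (enn2real (H x) powr q) \<partial>lborel) \<le> ennreal ((2 * (A + B)) powr q * (p / (p - 1)))"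
    unfolding W_def using p by (subst ennreal_mult) auto
qed

text \<open>The constants of the strong bound are compared with the claimed order. \<open>A\<close>
  is free of \<open>p\<close>; \<open>B\<close> grows like the power \<open>1 - 1 / p\<close> of
  \<open>1 / \<delta>\<close>, and \<open>1 - 1 / p \<le> \<kappa>\<close>; the factor
  \<open>p / (p - 1) = d / \<epsilon>\<close> sits under a \<open>q\<close>-th root, and
  \<open>1 / q \<le> \<kappa>\<close>. Each endpoint thus costs at most the power \<kappa>.\<close>

lemma riesz_pos_upper_unweighted:
  fixes l :: real
  assumes l: "l > 0" "l < DIM('a::euclidean_space)"
  defines "\<kappa> \<equiv> l / DIM('a)"
  shows "\<exists>C>0. \<forall>p q \<epsilon> \<delta> (g :: 'a \<Rightarrow> real). p > 1 \<longrightarrow> q > p \<longrightarrow> 1 + 1 / q = 1 / p + \<kappa> \<longrightarrow>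
     \<epsilon> = DIM('a) - DIM('a) / p \<longrightarrow> \<epsilon> > 0 \<longrightarrow> \<delta> = l - \<epsilon> \<longrightarrow> \<delta> > 0 \<longrightarrow>
     g \<in> borel_measurable borel \<longrightarrow> (\<forall>y. g y \<ge> 0) \<longrightarrow> (\<integral>\<^sup>+y. ennreal (g y powr p) \<partial>lborel) \<le> 1 \<longrightarrow>
     (AE x in lborel. riesz_pos 0 0 l g x < \<infinity>) \<and>
     (\<integral>\<^sup>+x. ennreal (enn2real (riesz_pos 0 0 l g x) powr q) \<partial>lborel) \<le> ennreal ((C / (\<epsilon> * \<delta>) powr \<kappa>) powr q)"
proof -
  let ?d = "real DIM('a)"
  define S where "S = sphere_area TYPE('a)"
  have S: "S > 0" unfolding S_def by (rule sphere_area_pos)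
  have \<kappa>: "\<kappa> > 0" using l by (simp add: \<kappa>_def)
  define A where "A = S / (?d - l)"
  have A: "A > 0" using S l by (simp add: A_def)
  define C where "C = 2 * (A * l powr \<kappa> + (S + l) powr \<kappa>) * ?d powr \<kappa>"
  have C: "C > 0" unfolding C_def using A S l \<kappa> by (intro mult_pos_pos add_pos_pos) auto
  have "(AE x in lborel. riesz_pos 0 0 l g x < \<infinity>) \<and>
     (\<integral>\<^sup>+x. ennreal (enn2real (riesz_pos 0 0 l g x) powr q) \<partial>lborel) \<le> ennreal ((C / (\<epsilon> * \<delta>) powr \<kappa>) powr q)"
    if p: "p > 1" "q > p" "1 + 1 / q = 1 / p + \<kappa>"
      and e: "\<epsilon> = ?d - ?d / p" "\<epsilon> > 0" "\<delta> = l - \<epsilon>" "\<delta> > 0"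
      and g0[measurable]: "g \<in> borel_measurable borel" and g: "\<forall>y. g y \<ge> 0" "(\<integral>\<^sup>+y. ennreal (g y powr p) \<partial>lborel) \<le> 1"
    for p q \<epsilon> \<delta> and g :: "'a \<Rightarrow> real"
  proof -
    define H where "H x = (\<integral>\<^sup>+y. ennreal (g y * norm (x - y) powr (- l)) \<partial>lborel)" for x
    define B where "B = (S * (1 - 1 / p) / \<delta>) powr (1 - 1 / p)"
    have \<delta>: "\<delta> = l - ?d + ?d / p" using e by simp
    have q: "q > 0" using p by simp
    have H: "AE x in lborel. H x < \<infinity>"
      "(\<integral>\<^sup>+x. ennreal (enn2real (H x) powr q) \<partial>lborel) \<le> ennreal ((2 * (A + B)) powr q * (p / (p - 1)))"
      using Riesz_strong_bound[OF g0 _ g(2) p(1) q p(3)[unfolded \<kappa>_def] l(2) \<delta> e(4)] g(1)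
      unfolding H_def A_def B_def S_def by auto
    \<comment> \<open>Only an inequality: since \<open>0 powr 0 = 0\<close>, the integrand of
      \<open>riesz_pos\<close> vanishes at \<open>x = 0\<close> and at \<open>y = 0\<close>.\<close>
    have le: "riesz_pos 0 0 l g x \<le> H x" for x
      unfolding riesz_pos_def H_def riesz_integrand_def
      by (intro nn_integral_mono ennreal_leI) (use g in \<open>auto simp: powr_minus_divide powr_zero_eq_one\<close>)
    have "AE x in lborel. riesz_pos 0 0 l g x < \<infinity>"
      using H(1) by eventually_elim (rule le_less_trans[OF le])
    moreover have "(\<integral>\<^sup>+x. ennreal (enn2real (riesz_pos 0 0 l g x) powr q) \<partial>lborel) \<le> (\<integral>\<^sup>+x. ennreal (enn2real (H x) powr q) \<partial>lborel)"
    proof (rule nn_integral_mono_AE)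
      show "AE x in lborel. ennreal (enn2real (riesz_pos 0 0 l g x) powr q) \<le> ennreal (enn2real (H x) powr q)"
        using H(1)
      proof eventually_elim
        case (elim x)
        have "enn2real (riesz_pos 0 0 l g x) \<le> enn2real (H x)" using le elim by (intro enn2real_mono) auto
        then show ?case using q by (intro ennreal_leI powr_mono2) auto
      qed
    qed
    moreover have "(2 * (A + B)) powr q * (p / (p - 1)) \<le> (C / (\<epsilon> * \<delta>) powr \<kappa>) powr q"
    proof -
      have e': "\<epsilon> = ?d * (1 - 1 / p)" using e by (simp add: algebra_simps)
      have pp: "p / (p - 1) = ?d / \<epsilon>" using p unfolding e' by (simp add: field_simps)
      have "1 / p < 1" using p by simp
      then have "\<epsilon> \<le> ?d" unfolding e' using p by simp
      then have de: "?d / \<epsilon> \<ge> 1" using e by (simp add: field_simps)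
      have "1 / q \<le> \<kappa>" using p(3) \<open>1 / p < 1\<close> by linarith
      then have kq: "\<kappa> * q \<ge> 1" using q by (simp add: divide_le_eq)
      have "p / (p - 1) = (?d / \<epsilon>) powr 1" using pp e(2) by simp
      also have "\<dots> \<le> (?d / \<epsilon>) powr (\<kappa> * q)" using de kq by (intro powr_mono) auto
      also have "\<dots> = ((?d / \<epsilon>) powr \<kappa>) powr q" by (simp add: powr_powr)
      finally have 1: "p / (p - 1) \<le> ((?d / \<epsilon>) powr \<kappa>) powr q" .
      have l\<delta>: "l / \<delta> \<ge> 1" using e by (simp add: field_simps)
      have 2: "A \<le> A * (l / \<delta>) powr \<kappa>" using A ge_one_powr_ge_zero[OF l\<delta>, of \<kappa>] \<kappa> by simp
      have "1 / q > 0" using q by simp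
      then have pk: "1 - 1 / p \<le> \<kappa>" "1 - 1 / p > 0" using p(3) \<open>1 / p < 1\<close> by linarith+
      \<comment> \<open>\<open>S + l\<close> replaces \<open>S\<close> to make the base at least 1,
        as \<open>\<delta> < l\<close>; the exponent may then be raised from
        \<open>1 - 1 / p\<close> to \<kappa>.\<close>
      have "B \<le> ((S + l) / \<delta>) powr (1 - 1 / p)"
        unfolding B_def
      proof (rule powr_mono2)
        have "S * (1 - 1 / p) \<le> S * 1" using S p by (intro mult_left_mono) auto
        then show "S * (1 - 1 / p) / \<delta> \<le> (S + l) / \<delta>" using l e by (intro divide_right_mono) auto
      qed (use pk S e in auto)
      also have "\<dots> \<le> ((S + l) / \<delta>) powr \<kappa>"
        using pk S e by (intro powr_mono) (auto simp: field_simps)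
      finally have 3: "B \<le> ((S + l) / \<delta>) powr \<kappa>" .
      have "A * (l / \<delta>) powr \<kappa> + ((S + l) / \<delta>) powr \<kappa> = (A * l powr \<kappa> + (S + l) powr \<kappa>) / \<delta> powr \<kappa>"
        using l S e(2,4) by (simp add: powr_divide add_divide_distrib[of _ _ "\<delta> powr \<kappa>"])
      then have "A + B \<le> (A * l powr \<kappa> + (S + l) powr \<kappa>) / \<delta> powr \<kappa>"
        using add_mono[OF 2 3] by (simp only:)
      then have 4: "2 * (A + B) \<le> 2 * ((A * l powr \<kappa> + (S + l) powr \<kappa>) / \<delta> powr \<kappa>)"
        by (rule mult_left_mono) simp
      have B: "B \<ge> 0" by (simp add: B_def)
      have "(2 * (A + B)) powr q * (p / (p - 1)) \<le> (2 * ((A * l powr \<kappa> + (S + l) powr \<kappa>) / \<delta> powr \<kappa>)) powr q * ((?d / \<epsilon>) powr \<kappa>) powr q"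
      proof (rule mult_mono[OF powr_mono2[OF _ _ 4] 1])
        show "0 \<le> q" "0 \<le> 2 * (A + B)" "0 \<le> p / (p - 1)" using A B q p by auto
      qed simp
      also have "\<dots> = (2 * ((A * l powr \<kappa> + (S + l) powr \<kappa>) / \<delta> powr \<kappa>) * (?d / \<epsilon>) powr \<kappa>) powr q"
        by (rule powr_mult[symmetric])
      also have "2 * ((A * l powr \<kappa> + (S + l) powr \<kappa>) / \<delta> powr \<kappa>) * (?d / \<epsilon>) powr \<kappa> = C / (\<epsilon> * \<delta>) powr \<kappa>"
        using e l by (simp add: C_def powr_mult powr_divide)
      finally show ?thesis .
    qed
    ultimately show ?thesis using H(2) by (meson ennreal_leI order.trans)
  qed
  with C show ?thesis by (intro exI[of _ C] conjI allI impI) blast+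
qed

section \<open>Lower bound\<close>

text \<open>
  The operator is tested on \<open>norm y powr (- d / p)\<close> restricted to one annulus, and its image is
  estimated on another, disjoint one, so that the value \<open>0\<close> of the integrand at \<open>y = x\<close> does no harm.
\<close>

lemma riesz_V_ge_annuli:
  fixes \<alpha> \<beta> l p q c m a b a' b' :: real
  defines "Y \<equiv> {y::'a::euclidean_space. a \<le> norm y \<and> norm y \<le> b}"
    and "X \<equiv> {x::'a. a' \<le> norm x \<and> norm x \<le> b'}"
  assumes q: "q = riesz_q DIM('a) \<alpha> \<beta> l p" "q > 0" and p: "p > 0"
    and ab: "0 < a" "a \<le> b" "0 < a'" "a' \<le> b'" and m: "m > 0" and c: "c > 0"
    and mY: "sphere_area TYPE('a) * (ln b - ln a) = m" and mX: "sphere_area TYPE('a) * (ln b' - ln a') = m"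
    and pm: "p_minus DIM('a) \<alpha> > 0"
    and K: "\<And>x y. x \<in> X \<Longrightarrow> y \<in> Y \<Longrightarrow> c * (norm x powr (- real DIM('a) / q) * norm y powr (- real DIM('a)))
        \<le> norm x powr (- \<beta>) * (norm y powr (- real DIM('a) / p) * norm y powr (- \<alpha>) / norm (x - y) powr l)"
  shows "ennreal (c * m powr (1 + 1 / q - 1 / p)) \<le> riesz_V TYPE('a) \<alpha> \<beta> l p"
proof -
  let ?d = "real DIM('a)"
  define f where "f y = norm y powr (- ?d / p) * indicator Y y" for y
  have [measurable]: "Y \<in> sets borel" "X \<in> sets borel" unfolding Y_def X_def by measurable
  have fm[measurable]: "f \<in> borel_measurable borel" unfolding f_def by measurable
  have fl: "f \<in> borel_measurable lebesgue" by (simp add: measurable_completion)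
  have Ypos: "norm y > 0" if "y \<in> Y" for y using that ab by (auto simp: Y_def)
  have Xpos: "norm y > 0" if "y \<in> X" for y using that ab by (auto simp: X_def)
  have iY: "(\<integral>\<^sup>+y. ennreal (norm y powr (- ?d)) * indicator Y y \<partial>lborel) = ennreal m"
    unfolding Y_def using nn_integral_powr_norm_annulus[where 'a='a, OF ab(1,2)] mY by simp
  have iX: "(\<integral>\<^sup>+y. ennreal (norm y powr (- ?d)) * indicator X y \<partial>lborel) = ennreal m"
    unfolding X_def using nn_integral_powr_norm_annulus[where 'a='a, OF ab(3,4)] mX by simp
  have fp: "(\<integral>\<^sup>+y. ennreal (\<bar>f y\<bar> powr p) \<partial>lebesgue) = ennreal m"
  proof -
    have "(\<integral>\<^sup>+y. ennreal (\<bar>f y\<bar> powr p) \<partial>lebesgue) = (\<integral>\<^sup>+y. ennreal (norm y powr (- ?d)) * indicator Y y \<partial>lborel)"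
      unfolding nn_integral_completion
      using p by (intro nn_integral_cong) (auto simp: f_def powr_powr abs_mult split: split_indicator)
    then show ?thesis using iY by simp
  qed
  have Lp: "Lnorm p f = ennreal (m powr (1 / p))"
    unfolding Lnorm_def fp using m by simp
  \<comment> \<open>The test function is bounded by its value at the inner radius and supported in a
    ball, so it lies in every space of positive exponent.\<close>
  have "f \<in> Lspace s" if s: "s > 0" for s
  proof -
    have "(\<integral>\<^sup>+y. ennreal (\<bar>f y\<bar> powr s) \<partial>lborel) \<le> (\<integral>\<^sup>+y. ennreal ((a powr (- ?d / p)) powr s) * indicator (cball (0::'a) b) y \<partial>lborel)"
    proof (rule nn_integral_mono)
      fix y
      show "ennreal (\<bar>f y\<bar> powr s) \<le> ennreal ((a powr (- ?d / p)) powr s) * indicator (cball (0::'a) b) y"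
      proof (cases "y \<in> Y")
        case True
        have "norm y powr (- ?d / p) \<le> a powr (- ?d / p)"
          using True ab p by (intro powr_mono2') (auto simp: Y_def)
        then have "\<bar>f y\<bar> powr s \<le> (a powr (- ?d / p)) powr s"
          using True s by (intro powr_mono2) (auto simp: f_def)
        then show ?thesis using True by (auto simp: Y_def intro: ennreal_leI)
      qed (simp add: f_def)
    qed
    also have "\<dots> = ennreal ((a powr (- ?d / p)) powr s) * emeasure lborel (cball (0::'a) b)"
      by (rule nn_integral_cmult_indicator) simp
    also have "\<dots> < \<infinity>" using emeasure_lborel_cball_finite[of "0::'a" b] by (simp add: ennreal_mult_less_top)
    finally show ?thesis using fl by (auto simp: Lspace_def Lnorm_def nn_integral_completion Let_def)
  qed
  then have fL: "f \<in> Linter (p_minus DIM('a) \<alpha>) (p_plus DIM('a) \<alpha> l)"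
    unfolding Linter_def using pm by auto
  have fnz: "\<not> (AE x in lebesgue. f x = 0)"
  proof
    assume "AE x in lebesgue. f x = 0"
    then have "AE x in lebesgue. ennreal (\<bar>f x\<bar> powr p) = 0" by eventually_elim simp
    then have "(\<integral>\<^sup>+y. ennreal (\<bar>f y\<bar> powr p) \<partial>lebesgue) = (\<integral>\<^sup>+(y::'a). 0 \<partial>lebesgue)"
      by (rule nn_integral_cong_AE)
    then show False using fp m by simp
  qed
  \<comment> \<open>On \<open>X\<close> the image is at least
    \<open>c * m * norm x powr (- d / q)\<close>, and the \<open>q\<close>-th power of this has
    integral \<open>(c * m) powr q * m\<close> over \<open>X\<close>. If the integrals fail to
    converge absolutely, or the norm of the image diverges, the left side is compared with
    infinity.\<close>
  have low: "ennreal (c * m powr (1 + 1 / q)) \<le> weight_riesz_norm \<alpha> \<beta> l q f"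
  proof (cases "AE x in lebesgue. integrable lebesgue (riesz_integrand \<alpha> l f x)")
    case False then show ?thesis by (simp add: weight_riesz_norm_def)
  next
    case True
    have w: "c * m * norm x powr (- ?d / q) \<le> weight_riesz \<alpha> \<beta> l f x"
      if x: "x \<in> X" and int: "integrable lebesgue (riesz_integrand \<alpha> l f x)" for x
    proof -
      have nn: "riesz_integrand \<alpha> l f x y \<ge> 0" for y by (simp add: riesz_integrand_def f_def)
      have "ennreal (weight_riesz \<alpha> \<beta> l f x) = ennreal (norm x powr (- \<beta>)) * (\<integral>\<^sup>+y. ennreal (riesz_integrand \<alpha> l f x y) \<partial>lebesgue)"
        unfolding weight_riesz_def using nn_integral_eq_integral[OF int] nn by (simp add: ennreal_mult')
      also have "\<dots> = ennreal (norm x powr (- \<beta>)) * (\<integral>\<^sup>+y. ennreal (riesz_integrand \<alpha> l f x y) \<partial>lborel)"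
        by (simp add: nn_integral_completion)
      also have "\<dots> = (\<integral>\<^sup>+y. ennreal (norm x powr (- \<beta>) * riesz_integrand \<alpha> l f x y) \<partial>lborel)"
      proof -
        have [measurable]: "riesz_integrand \<alpha> l f x \<in> borel_measurable borel" by (rule riesz_integrand_measurable) simp
        show ?thesis by (simp add: nn_integral_cmult ennreal_mult')
      qed
      also have "\<dots> \<ge> (\<integral>\<^sup>+y. ennreal (c * norm x powr (- ?d / q)) * (ennreal (norm y powr (- ?d)) * indicator Y y) \<partial>lborel)"
      proof (rule nn_integral_mono)
        fix y
        show "ennreal (c * norm x powr (- ?d / q)) * (ennreal (norm y powr (- ?d)) * indicator Y y)
          \<le> ennreal (norm x powr (- \<beta>) * riesz_integrand \<alpha> l f x y)"
        proof (cases "y \<in> Y")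
          case True
          have "ennreal (c * norm x powr (- ?d / q)) * (ennreal (norm y powr (- ?d)) * indicator Y y)
            = ennreal (c * (norm x powr (- ?d / q) * norm y powr (- ?d)))"
            using True c by (simp add: ennreal_mult'[symmetric] mult.assoc)
          also have "\<dots> \<le> ennreal (norm x powr (- \<beta>) * riesz_integrand \<alpha> l f x y)"
            using K[OF x True] True by (intro ennreal_leI) (simp add: riesz_integrand_def f_def)
          finally show ?thesis .
        qed simp
      qed
      also have "(\<integral>\<^sup>+y. ennreal (c * norm x powr (- ?d / q)) * (ennreal (norm y powr (- ?d)) * indicator Y y) \<partial>lborel)
          = ennreal (c * norm x powr (- ?d / q)) * ennreal m"
        by (subst nn_integral_cmult) (simp_all add: iY)
      also have "\<dots> = ennreal (c * m * norm x powr (- ?d / q))"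
        using c m by (simp add: ennreal_mult''[symmetric] mult_ac)
      finally have "ennreal (c * m * norm x powr (- ?d / q)) \<le> ennreal (weight_riesz \<alpha> \<beta> l f x)" .
      moreover have "weight_riesz \<alpha> \<beta> l f x \<ge> 0" unfolding weight_riesz_def using nn by simp
      ultimately show ?thesis by (simp add: ennreal_le_iff)
    qed
    define J where "J = (\<integral>\<^sup>+x. ennreal (\<bar>weight_riesz \<alpha> \<beta> l f x\<bar> powr q) \<partial>lebesgue)"
    have "ennreal ((c * m) powr q * m) = ennreal ((c * m) powr q) * (\<integral>\<^sup>+x. ennreal (norm x powr (- ?d)) * indicator X x \<partial>lborel)"
      unfolding iX by (simp add: ennreal_mult')
    also have "\<dots> = (\<integral>\<^sup>+x. ennreal ((c * m) powr q) * (ennreal (norm x powr (- ?d)) * indicator X x) \<partial>lborel)"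
      by (rule nn_integral_cmult[symmetric]) simp
    also have "\<dots> = (\<integral>\<^sup>+x. ennreal ((c * m) powr q) * (ennreal (norm x powr (- ?d)) * indicator X x) \<partial>lebesgue)"
      by (simp add: nn_integral_completion)
    also have "\<dots> \<le> J" unfolding J_def
    proof (rule nn_integral_mono_AE)
      show "AE x in lebesgue. ennreal ((c * m) powr q) * (ennreal (norm x powr (- ?d)) * indicator X x) \<le> ennreal (\<bar>weight_riesz \<alpha> \<beta> l f x\<bar> powr q)"
        using True
      proof eventually_elim
        case (elim x)
        show ?case
        proof (cases "x \<in> X")
          case True
          have "(c * m * norm x powr (- ?d / q)) powr q \<le> \<bar>weight_riesz \<alpha> \<beta> l f x\<bar> powr q"
            using w[OF True elim] c m q by (intro powr_mono2) auto
          moreover have "(c * m * norm x powr (- ?d / q)) powr q = (c * m) powr q * norm x powr (- ?d)"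
            using q by (simp add: powr_mult powr_powr)
          ultimately show ?thesis using True by (simp add: ennreal_mult'[symmetric] ennreal_leI)
        qed simp
      qed
    qed
    finally have J: "ennreal ((c * m) powr q * m) \<le> J" .
    show ?thesis
    proof (cases "J = \<infinity>")
      case True' : True
      then show ?thesis using True by (simp add: weight_riesz_norm_def Lnorm_def J_def[symmetric])
    next
      case False
      have "(c * m) powr q * m \<le> enn2real J"
        using enn2real_mono[OF J] False m by (simp add: less_top)
      then have "((c * m) powr q * m) powr (1 / q) \<le> enn2real J powr (1 / q)"
        using m q by (intro powr_mono2) auto
      also have "((c * m) powr q * m) powr (1 / q) = c * m powr (1 + 1 / q)"
        using q c m by (simp add: powr_mult powr_powr powr_add)
      finally show ?thesis using True False
        by (simp add: weight_riesz_norm_def Lnorm_def J_def[symmetric] ennreal_leI)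
    qed
  qed
  have "ennreal (c * m powr (1 + 1 / q - 1 / p)) = ennreal (c * m powr (1 + 1 / q)) / ennreal (m powr (1 / p))"
    using c m by (simp add: divide_ennreal powr_diff)
  also have "\<dots> \<le> weight_riesz_norm \<alpha> \<beta> l q f / Lnorm p f"
    unfolding Lp by (rule divide_right_mono_ennreal[OF low])
  also have "\<dots> \<le> riesz_V TYPE('a) \<alpha> \<beta> l p"
    unfolding riesz_V_def q(1)[symmetric] using fL fnz by (intro SUP_upper) auto
  finally show ?thesis .
qed

text \<open>For the bound in \<epsilon> the source annulus lies inside the target annulus, separated
  by a gap, and both have logarithmic width \<open>1 / (3 * \<epsilon>)\<close>. All radii lie
  between \<open>exp (- 1 / \<epsilon>)\<close> and 1, so \<open>norm y powr \<epsilon>\<close>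
  loses at most the factor \<open>exp (- 1)\<close>, while
  \<open>norm (x - y) \<le> 2 * norm x\<close> costs \<open>2 powr (- l)\<close>. The mass of each
  annulus enters with the exponent \<open>1 + 1 / q - 1 / p = \<kappa>\<close>.\<close>

lemma riesz_V_lower:
  fixes \<alpha> \<beta> l p q \<epsilon> \<delta> :: real
  defines "\<kappa> \<equiv> (\<alpha> + \<beta> + l) / DIM('a::euclidean_space)"
  assumes ab: "\<alpha> \<ge> 0" "\<beta> \<ge> 0" "l > 0"
    and q: "q = riesz_q DIM('a) \<alpha> \<beta> l p" "q > 0" "1 + 1 / q = 1 / p + \<kappa>" and p: "p > 0"
    and pm: "p_minus DIM('a) \<alpha> > 0"
    and e: "\<epsilon> = DIM('a) - \<alpha> - DIM('a) / p" "\<epsilon> > 0" "\<delta> = l - \<epsilon>" "\<delta> > 0"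
  shows "ennreal (2 powr (- l) * exp (- 1) * (sphere_area TYPE('a) / (3 * \<epsilon>)) powr \<kappa>) \<le> riesz_V TYPE('a) \<alpha> \<beta> l p"
    and "ennreal (2 powr (- l) * exp (- 1) * (sphere_area TYPE('a) / (3 * \<delta>)) powr \<kappa>) \<le> riesz_V TYPE('a) \<alpha> \<beta> l p"
proof -
  let ?d = "real DIM('a)"
  let ?S = "sphere_area TYPE('a)"
  have S: "?S > 0" by (rule sphere_area_pos)
  have kq: "\<kappa> = 1 + 1 / q - 1 / p" using q by simp
  have d: "?d > 0" by simp
  have "?d * (1 + 1 / q) = ?d * (1 / p + \<kappa>)" using q(3) by simp
  then have "?d + ?d / q = ?d / p + ?d * \<kappa>" by (simp add: distrib_left)
  moreover have "?d * \<kappa> = \<alpha> + \<beta> + l" by (simp add: \<kappa>_def)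
  ultimately have dq: "\<beta> = ?d / q - \<delta>" and dp: "?d / p + \<alpha> = ?d - \<epsilon>" using e by linarith+
  \<comment> \<open>\<open>x \<noteq> y\<close> matters: on the diagonal the quotient has the
    default value 0.\<close>
  have dist: "1 / norm (x - y) powr l \<ge> 2 powr (- l) * z powr (- l)"
    if "norm x \<le> z" "norm y \<le> z" "x \<noteq> y" for x y :: 'a and z
  proof -
    have "norm (x - y) \<le> 2 * z" using norm_triangle_ineq4[of x y] that by linarith
    then have "norm (x - y) powr (- l) \<ge> (2 * z) powr (- l)"
      using that ab by (intro powr_mono2') auto
    then show ?thesis by (simp add: powr_mult powr_minus_divide)
  qed
  have big: "s powr h \<ge> exp (- 1)" if "h > 0" "s \<ge> exp (- 1 / h)" for s h :: real
  proof -
    have "exp (- 1 / h) powr h \<le> s powr h" using that by (intro powr_mono2) auto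
    moreover have "exp (- 1 / h) powr h = exp (- 1)" using that by (simp add: powr_def)
    ultimately show ?thesis by simp
  qed
  have small: "s powr h \<ge> 1" if "h \<le> 0" "s \<le> 1" "s > 0" for s h :: real
    using powr_mono2'[of h s 1] that by simp
  show "ennreal (2 powr (- l) * exp (- 1) * (?S / (3 * \<epsilon>)) powr \<kappa>) \<le> riesz_V TYPE('a) \<alpha> \<beta> l p"
    unfolding kq
  proof (rule riesz_V_ge_annuli[where a="exp (- 1 / \<epsilon>)" and b="exp (- 2 / (3 * \<epsilon>))" and a'="exp (- 1 / (3 * \<epsilon>))" and b'=1, OF q(1,2) p])
    fix x y :: 'a
    assume x: "x \<in> {x. exp (- 1 / (3 * \<epsilon>)) \<le> norm x \<and> norm x \<le> 1}"
      and y: "y \<in> {x. exp (- 1 / \<epsilon>) \<le> norm x \<and> norm x \<le> exp (- 2 / (3 * \<epsilon>))}"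
    have lt: "exp (- 2 / (3 * \<epsilon>)) < exp (- 1 / (3 * \<epsilon>))" using e(2) by (simp add: field_simps)
    have x0: "norm x > 0" using x less_le_trans[OF exp_gt_zero] by blast
    have y0: "norm y > 0" using y less_le_trans[OF exp_gt_zero] by blast
    have yx: "norm y < norm x" using x y lt by (simp only: mem_Collect_eq) linarith
    have D: "2 powr (- l) * norm x powr (- l) \<le> 1 / norm (x - y) powr l" using yx by (intro dist) auto
    have "2 powr (- l) * exp (- 1) * (norm x powr (- ?d / q) * norm y powr (- ?d))
      \<le> 2 powr (- l) * norm y powr \<epsilon> * (norm x powr (- ?d / q) * norm y powr (- ?d)) * norm x powr (- \<epsilon>)"
    proof -
      have "exp (- 1) \<le> norm y powr \<epsilon>" using y e by (intro big) auto
      moreover have "1 \<le> norm x powr (- \<epsilon>)" using x x0 e(2) by (intro small) auto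
      ultimately have "exp (- 1) * 1 \<le> norm y powr \<epsilon> * norm x powr (- \<epsilon>)" by (intro mult_mono) auto
      then have "2 powr (- l) * (norm x powr (- ?d / q) * norm y powr (- ?d)) * (exp (- 1) * 1)
         \<le> 2 powr (- l) * (norm x powr (- ?d / q) * norm y powr (- ?d)) * (norm y powr \<epsilon> * norm x powr (- \<epsilon>))"
        by (rule mult_left_mono) auto
      then show ?thesis by (simp only: mult_ac mult_1_right)
    qed
    also have "\<dots> = 2 powr (- l) * (norm x powr (- ?d / q) * norm x powr (- \<epsilon>)) * (norm y powr (- ?d) * norm y powr \<epsilon>)" by simp
    also have "norm x powr (- ?d / q) * norm x powr (- \<epsilon>) = norm x powr (- \<beta>) * norm x powr (- l)"
    proof -
      have "- ?d / q + - \<epsilon> = - \<beta> + - l" using dq e(3) by simp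
      then show ?thesis by (simp only: powr_add[symmetric])
    qed
    also have "norm y powr (- ?d) * norm y powr \<epsilon> = norm y powr (- ?d / p) * norm y powr (- \<alpha>)"
    proof -
      have "- ?d + \<epsilon> = - ?d / p + - \<alpha>" using dp by simp
      then show ?thesis by (simp only: powr_add[symmetric])
    qed
    also have "2 powr (- l) * (norm x powr (- \<beta>) * norm x powr (- l)) * (norm y powr (- ?d / p) * norm y powr (- \<alpha>))
      = norm x powr (- \<beta>) * (norm y powr (- ?d / p) * norm y powr (- \<alpha>)) * (2 powr (- l) * norm x powr (- l))" by simp
    also have "\<dots> \<le> norm x powr (- \<beta>) * (norm y powr (- ?d / p) * norm y powr (- \<alpha>)) * (1 / norm (x - y) powr l)"
      by (intro mult_left_mono D) auto
    finally show "2 powr (- l) * exp (- 1) * (norm x powr (- ?d / q) * norm y powr (- ?d))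
       \<le> norm x powr (- \<beta>) * (norm y powr (- ?d / p) * norm y powr (- \<alpha>) / norm (x - y) powr l)" by simp
  qed (use pm S e(2) in \<open>auto simp: field_simps\<close>)
  show "ennreal (2 powr (- l) * exp (- 1) * (?S / (3 * \<delta>)) powr \<kappa>) \<le> riesz_V TYPE('a) \<alpha> \<beta> l p"
    unfolding kq
  \<comment> \<open>The same radii with \<delta> for \<epsilon>, and the annuli of \<open>x\<close>
    and \<open>y\<close> exchanged: the source now lies outside the target.\<close>
  proof (rule riesz_V_ge_annuli[where a'="exp (- 1 / \<delta>)" and b'="exp (- 2 / (3 * \<delta>))" and a="exp (- 1 / (3 * \<delta>))" and b=1, OF q(1,2) p])
    fix x y :: 'a
    assume y: "y \<in> {x. exp (- 1 / (3 * \<delta>)) \<le> norm x \<and> norm x \<le> 1}"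
      and x: "x \<in> {x. exp (- 1 / \<delta>) \<le> norm x \<and> norm x \<le> exp (- 2 / (3 * \<delta>))}"
    have lt: "exp (- 2 / (3 * \<delta>)) < exp (- 1 / (3 * \<delta>))" using e(4) by (simp add: field_simps)
    have x0: "norm x > 0" using x less_le_trans[OF exp_gt_zero] by blast
    have y0: "norm y > 0" using y less_le_trans[OF exp_gt_zero] by blast
    have yx: "norm x < norm y" using x y lt by (simp only: mem_Collect_eq) linarith
    have D: "2 powr (- l) * norm y powr (- l) \<le> 1 / norm (x - y) powr l" using yx by (intro dist) auto
    have "2 powr (- l) * exp (- 1) * (norm x powr (- ?d / q) * norm y powr (- ?d))
      \<le> 2 powr (- l) * norm x powr \<delta> * (norm x powr (- ?d / q) * norm y powr (- ?d)) * norm y powr (- \<delta>)"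
    proof -
      have "exp (- 1) \<le> norm x powr \<delta>" using x e(4) by (intro big) auto
      moreover have "1 \<le> norm y powr (- \<delta>)" using y y0 e(4) by (intro small) auto
      ultimately have "exp (- 1) * 1 \<le> norm x powr \<delta> * norm y powr (- \<delta>)" by (intro mult_mono) auto
      then have "2 powr (- l) * (norm x powr (- ?d / q) * norm y powr (- ?d)) * (exp (- 1) * 1)
         \<le> 2 powr (- l) * (norm x powr (- ?d / q) * norm y powr (- ?d)) * (norm x powr \<delta> * norm y powr (- \<delta>))"
        by (rule mult_left_mono) auto
      then show ?thesis by (simp only: mult_ac mult_1_right)
    qed
    also have "\<dots> = 2 powr (- l) * (norm x powr (- ?d / q) * norm x powr \<delta>) * (norm y powr (- ?d) * norm y powr (- \<delta>))" by simp
    also have "norm x powr (- ?d / q) * norm x powr \<delta> = norm x powr (- \<beta>)"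
      using dq by (simp add: powr_add[symmetric])
    also have "norm y powr (- ?d) * norm y powr (- \<delta>) = norm y powr (- ?d / p) * norm y powr (- \<alpha>) * norm y powr (- l)"
    proof -
      have "- ?d + - \<delta> = - ?d / p + - \<alpha> + - l" using dp e(3) by simp
      then show ?thesis by (simp only: powr_add[symmetric])
    qed
    also have "2 powr (- l) * norm x powr (- \<beta>) * (norm y powr (- ?d / p) * norm y powr (- \<alpha>) * norm y powr (- l))
      = norm x powr (- \<beta>) * (norm y powr (- ?d / p) * norm y powr (- \<alpha>)) * (2 powr (- l) * norm y powr (- l))" by simp
    also have "\<dots> \<le> norm x powr (- \<beta>) * (norm y powr (- ?d / p) * norm y powr (- \<alpha>)) * (1 / norm (x - y) powr l)"
      by (intro mult_left_mono D) auto
    finally show "2 powr (- l) * exp (- 1) * (norm x powr (- ?d / q) * norm y powr (- ?d))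
       \<le> norm x powr (- \<beta>) * (norm y powr (- ?d / p) * norm y powr (- \<alpha>) / norm (x - y) powr l)" by simp
  qed (use pm S e(4) in \<open>auto simp: field_simps\<close>)
qed

section \<open>Two-sided bound\<close>

text \<open>The two regimes are exhaustive: \<open>\<alpha> + \<beta> = 0\<close> is exactly the
  case in which the diagonal singularity is critical.\<close>

lemma riesz_pos_upper:
  fixes \<alpha> \<beta> l :: real
  assumes ab: "\<alpha> \<ge> 0" "\<beta> \<ge> 0" "l > 0" "\<alpha> + \<beta> + l < DIM('a::euclidean_space)"
  defines "\<kappa> \<equiv> (\<alpha> + \<beta> + l) / DIM('a)"
  shows "\<exists>C>0. \<forall>p q \<epsilon> \<delta> (g :: 'a \<Rightarrow> real). p > 1 \<longrightarrow> q > p \<longrightarrow> 1 + 1 / q = 1 / p + \<kappa> \<longrightarrow>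
     \<epsilon> = DIM('a) - \<alpha> - DIM('a) / p \<longrightarrow> \<epsilon> > 0 \<longrightarrow> \<delta> = l - \<epsilon> \<longrightarrow> \<delta> > 0 \<longrightarrow>
     g \<in> borel_measurable borel \<longrightarrow> (\<forall>y. g y \<ge> 0) \<longrightarrow> (\<integral>\<^sup>+y. ennreal (g y powr p) \<partial>lborel) \<le> 1 \<longrightarrow>
     (AE x in lborel. riesz_pos \<alpha> \<beta> l g x < \<infinity>) \<and>
     (\<integral>\<^sup>+x. ennreal (enn2real (riesz_pos \<alpha> \<beta> l g x) powr q) \<partial>lborel) \<le> ennreal ((C / (\<epsilon> * \<delta>) powr \<kappa>) powr q)"
proof (cases "\<alpha> + \<beta> > 0")
  case True
  then show ?thesis using riesz_pos_upper_weighted[where 'a='a, OF ab True] unfolding \<kappa>_def by simp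
next
  case False
  then have "\<alpha> = 0" "\<beta> = 0" using ab by auto
  then show ?thesis using riesz_pos_upper_unweighted[where 'a='a, of l] ab unfolding \<kappa>_def by simp
qed

section \<open>From normalised nonnegative functions to the operator norm\<close>

text \<open>\<open>f\<close> is replaced by the absolute value of a Borel representative, divided by
  its norm \<open>W\<close>; a change on a null set affects no integral. The image of
  \<open>f\<close> is dominated by \<open>W\<close> times the potential of \<open>g\<close>, whose
  finiteness almost everywhere yields the absolute convergence that \<open>weight_riesz_norm\<close>
  asks for.\<close>

lemma weight_riesz_norm_le:
  fixes \<alpha> \<beta> l p q D :: real and f :: "'a::euclidean_space \<Rightarrow> real"
  assumes f: "f \<in> Lspace p" "\<not> (AE x in lebesgue. f x = 0)" and p: "p > 0" "q > 0" and D: "D \<ge> 0"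
    and bound: "\<And>g :: 'a \<Rightarrow> real. g \<in> borel_measurable borel \<Longrightarrow> (\<And>y. g y \<ge> 0) \<Longrightarrow> (\<integral>\<^sup>+y. ennreal (g y powr p) \<partial>lborel) \<le> 1 \<Longrightarrow>
     (AE x in lborel. riesz_pos \<alpha> \<beta> l g x < \<infinity>) \<and>
     (\<integral>\<^sup>+x. ennreal (enn2real (riesz_pos \<alpha> \<beta> l g x) powr q) \<partial>lborel) \<le> ennreal (D powr q)"
  shows "weight_riesz_norm \<alpha> \<beta> l q f / Lnorm p f \<le> ennreal D"
proof -
  have fm[measurable]: "f \<in> borel_measurable lebesgue" using f(1) by (simp add: Lspace_def)
  define J where "J = (\<integral>\<^sup>+x. ennreal (\<bar>f x\<bar> powr p) \<partial>lebesgue)"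
  have Jfin: "J \<noteq> \<infinity>" using f(1) by (auto simp: Lspace_def Lnorm_def J_def[symmetric] Let_def split: if_splits)
  have "J \<noteq> 0"
  proof
    assume "J = 0"
    then have "AE x in lebesgue. ennreal (\<bar>f x\<bar> powr p) = 0" unfolding J_def by (subst (asm) nn_integral_0_iff_AE) auto
    then have "AE x in lebesgue. f x = 0" by eventually_elim auto
    then show False using f(2) by simp
  qed
  define j where "j = enn2real J"
  have Jj: "J = ennreal j" using Jfin by (simp add: j_def less_top)
  have j: "j > 0" using \<open>J \<noteq> 0\<close> Jfin unfolding j_def by (simp add: enn2real_positive_iff less_top zero_less_iff_neq_zero)
  define W where "W = j powr (1 / p)"
  have W: "W > 0" using j by (simp add: W_def)
  have L: "Lnorm p f = ennreal W" unfolding Lnorm_def J_def[symmetric] using Jfin by (simp add: j_def W_def)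
  obtain g0 where g0[measurable]: "g0 \<in> borel_measurable borel" and fg: "AE x in lborel. f x = g0 x"
    using completion_ex_borel_measurable_real[OF fm] by auto
  define g where "g y = \<bar>g0 y\<bar> / W" for y
  have gm[measurable]: "g \<in> borel_measurable borel" unfolding g_def by measurable
  have gn: "g y \<ge> 0" for y using W by (simp add: g_def)
  have Wp: "W powr p = j" using p j by (simp add: W_def powr_powr)
  have "(\<integral>\<^sup>+y. ennreal (g y powr p) \<partial>lborel) = (\<integral>\<^sup>+y. ennreal (1 / j) * ennreal (\<bar>f y\<bar> powr p) \<partial>lborel)"
  proof (rule nn_integral_cong_AE)
    show "AE y in lborel. ennreal (g y powr p) = ennreal (1 / j) * ennreal (\<bar>f y\<bar> powr p)"
      using fg
    proof eventually_elim
      case (elim y)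
      have "g y powr p = 1 / j * \<bar>f y\<bar> powr p" using W elim by (simp add: g_def powr_divide Wp)
      then show ?case by (simp only:) (rule ennreal_mult', use j in simp)
    qed
  qed
  also have "\<dots> = (\<integral>\<^sup>+y. ennreal (1 / j) * ennreal (\<bar>f y\<bar> powr p) \<partial>lebesgue)" by (simp add: nn_integral_completion)
  also have "\<dots> = ennreal (1 / j) * J" unfolding J_def by (rule nn_integral_cmult) simp
  also have "\<dots> = 1" using j unfolding Jj by (simp add: ennreal_mult'[symmetric])
  finally have "(\<integral>\<^sup>+y. ennreal (g y powr p) \<partial>lborel) \<le> 1" by simp
  from bound[OF gm gn this]
  have fin: "AE x in lborel. riesz_pos \<alpha> \<beta> l g x < \<infinity>"
    and bd: "(\<integral>\<^sup>+x. ennreal (enn2real (riesz_pos \<alpha> \<beta> l g x) powr q) \<partial>lborel) \<le> ennreal (D powr q)" by auto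
  have abs: "ennreal (norm x powr (- \<beta>)) * (\<integral>\<^sup>+y. ennreal (norm (riesz_integrand \<alpha> l f x y)) \<partial>lebesgue) = ennreal W * riesz_pos \<alpha> \<beta> l g x" for x
  proof -
    have [measurable]: "riesz_integrand \<alpha> l g x \<in> borel_measurable borel" by (rule riesz_integrand_measurable) simp
    have "(\<integral>\<^sup>+y. ennreal (norm (riesz_integrand \<alpha> l f x y)) \<partial>lebesgue) = (\<integral>\<^sup>+y. ennreal (W * riesz_integrand \<alpha> l g x y) \<partial>lborel)"
      unfolding nn_integral_completion
    proof (rule nn_integral_cong_AE)
      show "AE y in lborel. ennreal (norm (riesz_integrand \<alpha> l f x y)) = ennreal (W * riesz_integrand \<alpha> l g x y)"
        using fg by eventually_elim (use W in \<open>simp add: riesz_integrand_def g_def abs_mult\<close>)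
    qed
    also have "\<dots> = ennreal W * (\<integral>\<^sup>+y. ennreal (riesz_integrand \<alpha> l g x y) \<partial>lborel)"
      using W by (simp add: ennreal_mult' nn_integral_cmult)
    finally show ?thesis
      unfolding riesz_pos_def by (simp add: ennreal_mult' nn_integral_cmult mult_ac)
  qed
  have fm': "riesz_integrand \<alpha> l f x \<in> borel_measurable lebesgue" for x
  proof -
    have "(\<lambda>y. norm y powr (- \<alpha>) / norm (x - y) powr l) \<in> borel_measurable borel" by measurable
    then have [measurable]: "(\<lambda>y. norm y powr (- \<alpha>) / norm (x - y) powr l) \<in> borel_measurable lebesgue"
      by (simp add: measurable_completion)
    have "riesz_integrand \<alpha> l f x = (\<lambda>y. f y * (norm y powr (- \<alpha>) / norm (x - y) powr l))"
      by (simp add: riesz_integrand_def fun_eq_iff)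
    moreover have "(\<lambda>y. f y * (norm y powr (- \<alpha>) / norm (x - y) powr l)) \<in> borel_measurable lebesgue"
      by (rule borel_measurable_times) measurable
    ultimately show ?thesis by simp
  qed
  \<comment> \<open>The point \<open>x = 0\<close> is left out: the weight vanishes there, so a
    finite \<open>riesz_pos\<close> says nothing about the inner integral.\<close>
  have good: "AE x in lborel. integrable lebesgue (riesz_integrand \<alpha> l f x) \<and>
     \<bar>weight_riesz \<alpha> \<beta> l f x\<bar> \<le> W * enn2real (riesz_pos \<alpha> \<beta> l g x)"
    using fin AE_lborel_singleton[of 0]
  proof eventually_elim
    case (elim x)
    have "ennreal W * riesz_pos \<alpha> \<beta> l g x < \<infinity>" using elim(1) by (simp add: ennreal_mult_less_top)
    then have "ennreal (norm x powr (- \<beta>)) * (\<integral>\<^sup>+y. ennreal (norm (riesz_integrand \<alpha> l f x y)) \<partial>lebesgue) < \<infinity>" unfolding abs .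
    then have "(\<integral>\<^sup>+y. ennreal (norm (riesz_integrand \<alpha> l f x y)) \<partial>lebesgue) < \<infinity>"
      using elim(2) by (auto simp: ennreal_mult_less_top)
    then have int: "integrable lebesgue (riesz_integrand \<alpha> l f x)"
      by (intro integrableI_bounded fm')
    have "ennreal \<bar>weight_riesz \<alpha> \<beta> l f x\<bar> = ennreal (norm x powr (- \<beta>)) * ennreal (norm (\<integral>y. riesz_integrand \<alpha> l f x y \<partial>lebesgue))"
      by (simp add: weight_riesz_def abs_mult ennreal_mult')
    also have "\<dots> \<le> ennreal (norm x powr (- \<beta>)) * (\<integral>\<^sup>+y. ennreal (norm (riesz_integrand \<alpha> l f x y)) \<partial>lebesgue)"
      by (intro mult_left_mono integral_norm_bound_ennreal int) simp
    also have "\<dots> = ennreal W * ennreal (enn2real (riesz_pos \<alpha> \<beta> l g x))" unfolding abs using elim(1) by simp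
    also have "\<dots> = ennreal (W * enn2real (riesz_pos \<alpha> \<beta> l g x))" using W by (simp add: ennreal_mult')
    finally show ?case using int W by (simp add: ennreal_le_iff)
  qed
  then have "AE x in lborel. integrable lebesgue (riesz_integrand \<alpha> l f x)" by eventually_elim simp
  then have int: "AE x in lebesgue. integrable lebesgue (riesz_integrand \<alpha> l f x)" by (rule AE_completion)
  define N where "N = (\<integral>\<^sup>+x. ennreal (\<bar>weight_riesz \<alpha> \<beta> l f x\<bar> powr q) \<partial>lebesgue)"
  have rm[measurable]: "riesz_pos \<alpha> \<beta> l g \<in> borel_measurable borel" by (rule riesz_pos_measurable) simp
  have "N = (\<integral>\<^sup>+x. ennreal (\<bar>weight_riesz \<alpha> \<beta> l f x\<bar> powr q) \<partial>lborel)" by (simp add: N_def nn_integral_completion)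
  also have "\<dots> \<le> (\<integral>\<^sup>+x. ennreal (W powr q) * ennreal (enn2real (riesz_pos \<alpha> \<beta> l g x) powr q) \<partial>lborel)"
  proof (rule nn_integral_mono_AE)
    show "AE x in lborel. ennreal (\<bar>weight_riesz \<alpha> \<beta> l f x\<bar> powr q) \<le> ennreal (W powr q) * ennreal (enn2real (riesz_pos \<alpha> \<beta> l g x) powr q)"
      using good
    proof eventually_elim
      case (elim x)
      then have "\<bar>weight_riesz \<alpha> \<beta> l f x\<bar> powr q \<le> (W * enn2real (riesz_pos \<alpha> \<beta> l g x)) powr q"
        using p by (intro powr_mono2) auto
      then show ?case by (simp add: powr_mult ennreal_mult'[symmetric] ennreal_leI)
    qed
  qed
  also have "\<dots> = ennreal (W powr q) * (\<integral>\<^sup>+x. ennreal (enn2real (riesz_pos \<alpha> \<beta> l g x) powr q) \<partial>lborel)"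
    by (rule nn_integral_cmult) simp
  also have "\<dots> \<le> ennreal (W powr q) * ennreal (D powr q)" by (intro mult_left_mono bd) simp
  also have "\<dots> = ennreal ((W * D) powr q)" by (simp add: powr_mult ennreal_mult')
  finally have N: "N \<le> ennreal ((W * D) powr q)" .
  then have Nfin: "N \<noteq> \<infinity>" by (auto simp: top_unique)
  have "enn2real N powr (1 / q) \<le> ((W * D) powr q) powr (1 / q)"
    using N p by (intro powr_mono2 enn2real_leI) auto
  also have "\<dots> = W * D" using p W D by (simp add: powr_powr)
  finally have "weight_riesz_norm \<alpha> \<beta> l q f \<le> ennreal (W * D)"
    using int Nfin by (simp add: weight_riesz_norm_def Lnorm_def N_def[symmetric] ennreal_leI)
  then have "weight_riesz_norm \<alpha> \<beta> l q f / Lnorm p f \<le> ennreal (W * D) / ennreal W"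
    unfolding L by (rule divide_right_mono_ennreal)
  also have "\<dots> = ennreal D" using W D by (simp add: divide_ennreal)
  finally show ?thesis .
qed

theorem theorem1:
  fixes \<alpha> \<beta> l :: real
  assumes "\<alpha> \<ge> 0" "\<beta> \<ge> 0" "l > 0"
    and "\<alpha> + \<beta> + l < real DIM('a::euclidean_space)"
  shows "\<exists>C1 C2 :: real. C1 > 0 \<and> C2 > 0 \<and>
    (\<forall>p. p_minus DIM('a) \<alpha> < p \<and> p < p_plus DIM('a) \<alpha> l \<longrightarrow>
      ennreal (C1 / ((p - p_minus DIM('a) \<alpha>) * (p_plus DIM('a) \<alpha> l - p))
                      powr riesz_kappa DIM('a) \<alpha> \<beta> l)
        \<le> riesz_V TYPE('a) \<alpha> \<beta> l p \<and>
      riesz_V TYPE('a) \<alpha> \<beta> l p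
        \<le> ennreal (C2 / ((p - p_minus DIM('a) \<alpha>) * (p_plus DIM('a) \<alpha> l - p))
                      powr riesz_kappa DIM('a) \<alpha> \<beta> l))"
proof -
  note ab = assms
  let ?d = "real DIM('a)"
  define \<kappa> where "\<kappa> = (\<alpha> + \<beta> + l) / ?d"
  have \<kappa>: "\<kappa> > 0" "riesz_kappa DIM('a) \<alpha> \<beta> l = \<kappa>" using ab by (auto simp: \<kappa>_def riesz_kappa_def)
  define S where "S = sphere_area TYPE('a)"
  have S: "S > 0" unfolding S_def by (rule sphere_area_pos)
  \<comment> \<open>The distances of \<open>p\<close> from the endpoints are
    \<open>p * \<epsilon> / (d - \<alpha>)\<close> and
    \<open>p * \<delta> / (d - \<alpha> - l)\<close>; \<open>c0\<close> is the product of the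
    denominators.\<close>
  define c0 where "c0 = (?d - \<alpha>) * (?d - \<alpha> - l)"
  have da: "?d - \<alpha> > 0" "?d - \<alpha> - l > 0" "?d > 0" using ab by auto
  have c0: "c0 > 0" unfolding c0_def using da by simp
  define P where "P = p_plus DIM('a) \<alpha> l"
  have P: "P > 0" unfolding P_def p_plus_def using da by simp
  have pm: "p_minus DIM('a) \<alpha> \<ge> 1" unfolding p_minus_def using da ab by simp
  obtain C where C: "C > 0" and Cb: "\<And>p q \<epsilon> \<delta> (g :: 'a \<Rightarrow> real). p > 1 \<Longrightarrow> q > p \<Longrightarrow> 1 + 1 / q = 1 / p + \<kappa> \<Longrightarrow>
     \<epsilon> = ?d - \<alpha> - ?d / p \<Longrightarrow> \<epsilon> > 0 \<Longrightarrow> \<delta> = l - \<epsilon> \<Longrightarrow> \<delta> > 0 \<Longrightarrow>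
     g \<in> borel_measurable borel \<Longrightarrow> (\<And>y. g y \<ge> 0) \<Longrightarrow> (\<integral>\<^sup>+y. ennreal (g y powr p) \<partial>lborel) \<le> 1 \<Longrightarrow>
     (AE x in lborel. riesz_pos \<alpha> \<beta> l g x < \<infinity>) \<and>
     (\<integral>\<^sup>+x. ennreal (enn2real (riesz_pos \<alpha> \<beta> l g x) powr q) \<partial>lborel) \<le> ennreal ((C / (\<epsilon> * \<delta>) powr \<kappa>) powr q)"
    using riesz_pos_upper[where 'a='a, OF ab] unfolding \<kappa>_def by metis
  \<comment> \<open>The 6 in \<open>C1\<close> is the 3 from the annuli times the 2 from
    \<open>max \<epsilon> \<delta> \<ge> l / 2\<close>. In \<open>C2\<close>, \<open>P\<close>
    bounds \<open>p\<close> from above, while the lower bound uses \<open>p > 1\<close>.\<close>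
  define C1 where "C1 = 2 powr (- l) * exp (- 1) * (S * l / (6 * c0)) powr \<kappa>"
  define C2 where "C2 = C * (P\<^sup>2 / c0) powr \<kappa>"
  have C1: "C1 > 0" unfolding C1_def using S ab c0 by (intro mult_pos_pos) auto
  have C2: "C2 > 0" unfolding C2_def using C P c0 by (intro mult_pos_pos) auto
  have main: "ennreal (C1 / ((p - p_minus DIM('a) \<alpha>) * (p_plus DIM('a) \<alpha> l - p)) powr \<kappa>) \<le> riesz_V TYPE('a) \<alpha> \<beta> l p \<and>
      riesz_V TYPE('a) \<alpha> \<beta> l p \<le> ennreal (C2 / ((p - p_minus DIM('a) \<alpha>) * (p_plus DIM('a) \<alpha> l - p)) powr \<kappa>)"
    if p: "p_minus DIM('a) \<alpha> < p" "p < p_plus DIM('a) \<alpha> l" for p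
  proof -
    have p1: "p > 1" using pm p by simp
    define q where "q = riesz_q DIM('a) \<alpha> \<beta> l p"
    have dim: "DIM('a) \<ge> 1" by (simp add: Suc_leI)
    have q: "1 + 1 / q = 1 / p + \<kappa>" "q > p"
      using riesz_q[OF dim ab p] unfolding q_def \<kappa>_def by auto
    define \<epsilon> where "\<epsilon> = ?d - \<alpha> - ?d / p"
    define \<delta> where "\<delta> = l - \<epsilon>"
    have pe: "p - p_minus DIM('a) \<alpha> = p * \<epsilon> / (?d - \<alpha>)"
      using da p1 by (simp add: p_minus_def \<epsilon>_def field_simps)
    have pd: "p_plus DIM('a) \<alpha> l - p = p * \<delta> / (?d - \<alpha> - l)"
    proof -
      have "p * \<delta> = ?d - p * (?d - \<alpha> - l)"
        using p1 by (simp add: \<delta>_def \<epsilon>_def algebra_simps)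
      then show ?thesis using da(2) by (simp add: p_plus_def diff_divide_distrib)
    qed
    have "p * \<epsilon> / (?d - \<alpha>) > 0" "p * \<delta> / (?d - \<alpha> - l) > 0" using p pe pd by linarith+
    then have e: "\<epsilon> > 0" and dl: "\<delta> > 0" using da p1 by (simp_all add: zero_less_divide_iff zero_less_mult_iff)
    define X where "X = (p - p_minus DIM('a) \<alpha>) * (p_plus DIM('a) \<alpha> l - p)"
    have Xe: "X = p\<^sup>2 * (\<epsilon> * \<delta>) / c0" unfolding X_def pe pd c0_def by (simp add: power2_eq_square)
    have X: "X > 0" unfolding Xe using p1 e dl c0 by simp
    have ed: "\<epsilon> * \<delta> > 0" using e dl by simp
    have low: "ennreal (C1 / X powr \<kappa>) \<le> riesz_V TYPE('a) \<alpha> \<beta> l p"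
    proof -
      have "p_minus DIM('a) \<alpha> > 0" "q > 0" "p > 0" using pm q p1 by auto
      note V = riesz_V_lower[where 'a='a, OF ab(1-3) q_def \<open>q > 0\<close> q(1)[unfolded \<kappa>_def] \<open>p > 0\<close> this(1) \<epsilon>_def e \<delta>_def dl,
          folded \<kappa>_def S_def]
      \<comment> \<open>The better of the two lower bounds belongs to the smaller parameter. The
        larger one is at least \<open>l / 2\<close> since they add up to \<open>l\<close>, so \<mu>
        is at most a constant times \<open>\<epsilon> * \<delta>\<close>.\<close>
      define \<mu> where "\<mu> = min \<epsilon> \<delta>"
      have \<mu>: "\<mu> > 0" using e dl by (simp add: \<mu>_def)
      have V: "ennreal (2 powr (- l) * exp (- 1) * (S / (3 * \<mu>)) powr \<kappa>) \<le> riesz_V TYPE('a) \<alpha> \<beta> l p"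
        using V by (simp add: \<mu>_def min_def)
      have "\<mu> * (l / 2) \<le> \<epsilon> * \<delta>"
      proof (cases "\<epsilon> \<le> \<delta>")
        case True
        then have "\<mu> = \<epsilon>" "l / 2 \<le> \<delta>" by (auto simp: \<mu>_def \<delta>_def)
        then show ?thesis using e by simp
      next
        case False
        then have "\<mu> = \<delta>" "l / 2 \<le> \<epsilon>" by (auto simp: \<mu>_def \<delta>_def)
        then show ?thesis using dl by (simp add: mult.commute[of \<epsilon>])
      qed
      also have "\<epsilon> * \<delta> \<le> c0 * X"
      proof -
        have "1 \<le> p\<^sup>2" using p1 by simp
        then have "1 * (\<epsilon> * \<delta>) \<le> p\<^sup>2 * (\<epsilon> * \<delta>)" using ed by (intro mult_right_mono) auto
        then show ?thesis unfolding Xe using c0 by simp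
      qed
      finally have "S * l / (6 * c0) / X \<le> S / (3 * \<mu>)"
        using S \<mu> X c0 by (simp add: field_simps)
      then have "(S * l / (6 * c0) / X) powr \<kappa> \<le> (S / (3 * \<mu>)) powr \<kappa>"
        using S ab c0 X \<kappa> by (intro powr_mono2) auto
      then have "2 powr (- l) * exp (- 1) * (S * l / (6 * c0) / X) powr \<kappa> \<le> 2 powr (- l) * exp (- 1) * (S / (3 * \<mu>)) powr \<kappa>"
        by (intro mult_left_mono) auto
      moreover have "2 powr (- l) * exp (- 1) * (S * l / (6 * c0) / X) powr \<kappa> = C1 / X powr \<kappa>"
        unfolding C1_def using S ab c0 X by (subst powr_divide) auto
      ultimately show ?thesis using V by (metis ennreal_leI order.trans)
    qed
    define D where "D = C / (\<epsilon> * \<delta>) powr \<kappa>"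
    have D: "D \<ge> 0" using C by (simp add: D_def)
    have DX: "D \<le> C2 / X powr \<kappa>"
    proof -
      have "p\<^sup>2 \<le> P\<^sup>2" using p1 p(2) unfolding P_def by (intro power_mono) auto
      then have "p\<^sup>2 / c0 * (\<epsilon> * \<delta>) \<le> P\<^sup>2 / c0 * (\<epsilon> * \<delta>)"
        using c0 ed by (intro mult_right_mono divide_right_mono) auto
      then have "X \<le> P\<^sup>2 / c0 * (\<epsilon> * \<delta>)" unfolding Xe by simp
      then have "X powr \<kappa> \<le> (P\<^sup>2 / c0 * (\<epsilon> * \<delta>)) powr \<kappa>" using X \<kappa> by (intro powr_mono2) auto
      then have "X powr \<kappa> \<le> (P\<^sup>2 / c0) powr \<kappa> * (\<epsilon> * \<delta>) powr \<kappa>" by (simp only: powr_mult)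
      then have "C * X powr \<kappa> \<le> C2 * (\<epsilon> * \<delta>) powr \<kappa>" unfolding C2_def mult.assoc using C by (intro mult_left_mono) auto
      moreover have "X powr \<kappa> > 0" "(\<epsilon> * \<delta>) powr \<kappa> > 0" using X ed e dl by auto
      moreover have "a / u \<le> b / v" if "a * v \<le> b * u" "v > 0" "u > 0" for a b u v :: real
        using that by (simp add: field_simps)
      ultimately show ?thesis unfolding D_def by blast
    qed
    have "riesz_V TYPE('a) \<alpha> \<beta> l p \<le> ennreal D"
      unfolding riesz_V_def q_def[symmetric]
    proof (rule SUP_least)
      fix f :: "'a \<Rightarrow> real"
      assume "f \<in> {f. f \<in> Linter (p_minus DIM('a) \<alpha>) (p_plus DIM('a) \<alpha> l) \<and> \<not> (AE x in lebesgue. f x = 0)}"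
      then have "f \<in> Lspace p" "\<not> (AE x in lebesgue. f x = 0)" using p by (auto simp: Linter_def)
      then show "weight_riesz_norm \<alpha> \<beta> l q f / Lnorm p f \<le> ennreal D"
      proof (rule weight_riesz_norm_le)
        show "p > 0" "q > 0" "D \<ge> 0" using p1 q D by auto
        fix g :: "'a \<Rightarrow> real"
        assume "g \<in> borel_measurable borel" "\<And>y. g y \<ge> 0" "(\<integral>\<^sup>+y. ennreal (g y powr p) \<partial>lborel) \<le> 1"
        then show "(AE x in lborel. riesz_pos \<alpha> \<beta> l g x < \<infinity>) \<and>
           (\<integral>\<^sup>+x. ennreal (enn2real (riesz_pos \<alpha> \<beta> l g x) powr q) \<partial>lborel) \<le> ennreal (D powr q)"
          unfolding D_def by (rule Cb[OF p1 q(2,1) \<epsilon>_def e \<delta>_def dl])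
      qed
    qed
    also have "\<dots> \<le> ennreal (C2 / X powr \<kappa>)" by (rule ennreal_leI[OF DX])
    finally show ?thesis using low unfolding X_def by blast
  qed
  show ?thesis unfolding \<kappa>(2) by (intro exI[of _ C1] exI[of _ C2] conjI C1 C2 allI impI) (use main in auto)
qed

end
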